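(* Let $(X,d)$ be a proper geodesic Gromov hyperbolic metric space such that the horofunction compactification $\overline X^H$ is equivalent to the Gromov compactification $\overline X^G$. Let $f\colon X\to X$ be a non-expanding self-map and let $\eta\in\partial_GX$ be a boundary regular fixed point of $f$. Then for all $n\ge1$, $$\lambda_\eta(f^n)=\lambda_\eta(f)^n.$$
   Context: Non-expanding: $d(f(x),f(y))\le d(x,y)$. Gromov hyperbolic: for some $\delta>0$, in every geodesic triangle each side lies in the $\delta$-neighborhood of the union of the other two. $\partial_GX$ is the Gromov boundary, $\overline X^G=X\sqcup\partial_GX$. The horofunction compactification $\overline X^H$ is the closure, in $C(X)$ (topology of uniform convergence on compacta) modulo constants, of the classes of the functions $y\mapsto d(x,y)$, $x\in X$. The two compactifications are equivalent if the identity of $X$ extends to a homeomorphism $\overline X^H\to\overline X^G$. For non-expanding $g$, $\log\lambda_{\eta,p}(g)=\liminf_{z\to\eta}[d(z,p)-d(g(z),p)]$, $p\in X$. Geodesic region: $\{x\in X: d(x,\gamma)<R\}$ for a geodesic ray $\gamma$ and $R>0$, with vertex $[\gamma]\in\partial_GX$. $g$ has geodesic limit $\xi$ at $\eta$ if $g(x_n)\to\xi$ for every sequence $x_n\to\eta$ contained in a geodesic region with vertex $\eta$. $\eta$ is a boundary regular fixed point (BRFP) of $g$ if $\lambda_{\eta,p}(g)<+\infty$ and $g$ has geodesic limit $\eta$ at $\eta$. A BRFP of $f$ is a BRFP of all its iterates, and when the compactifications are equivalent the dilation at a BRFP does not depend on $p$ and is denoted $\lambda_\eta$. *)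

theory Defs
  imports "HOL-Analysis.Analysis"
begin

section \<open>Proper geodesic Gromov hyperbolic spaces\<close>

text \<open>The space \<open>X\<close> is a type of class \<^class>\<open>metric_space\<close>.\<close>

definition proper_space :: "'a::metric_space itself \<Rightarrow> bool" where
  "proper_space _ \<longleftrightarrow> (\<forall>(x::'a) r. compact (cball x r))"

definition isometric_on :: "real set \<Rightarrow> (real \<Rightarrow> 'a::metric_space) \<Rightarrow> bool" where
  "isometric_on I c \<longleftrightarrow> (\<forall>s\<in>I. \<forall>t\<in>I. dist (c s) (c t) = \<bar>s - t\<bar>)"

text \<open>\<open>S\<close> is the image of a geodesic joining \<open>x\<close> to \<open>y\<close>.\<close>

definition geodesic_segment :: "'a::metric_space set \<Rightarrow> 'a \<Rightarrow> 'a \<Rightarrow> bool" where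
  "geodesic_segment S x y \<longleftrightarrow>
     (\<exists>c. isometric_on {0..dist x y} c \<and> c 0 = x \<and> c (dist x y) = y \<and> S = c ` {0..dist x y})"

definition geodesic_space :: "'a::metric_space itself \<Rightarrow> bool" where
  "geodesic_space _ \<longleftrightarrow> (\<forall>x y::'a. \<exists>S. geodesic_segment S x y)"

definition neighborhood :: "'a::metric_space set \<Rightarrow> real \<Rightarrow> 'a set" where
  "neighborhood S r = {x. infdist x S < r}"

definition gromov_hyperbolic :: "'a::metric_space itself \<Rightarrow> bool" where
  "gromov_hyperbolic _ \<longleftrightarrow>
     (\<exists>\<delta>>0. \<forall>(x::'a) y z A B C.
        geodesic_segment A x y \<and> geodesic_segment B y z \<and> geodesic_segment C z x \<longrightarrow>
          A \<subseteq> neighborhood (B \<union> C) \<delta> \<and>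
          B \<subseteq> neighborhood (C \<union> A) \<delta> \<and>
          C \<subseteq> neighborhood (A \<union> B) \<delta>)"

definition non_expanding :: "('a::metric_space \<Rightarrow> 'a) \<Rightarrow> bool" where
  "non_expanding f \<longleftrightarrow> (\<forall>x y. dist (f x) (f y) \<le> dist x y)"


section \<open>The Gromov boundary and the Gromov compactification\<close>

text \<open>Only the values of a ray on \<open>{0..}\<close> matter.  Two functions that agree there are asymptotic,
  so the values at negative arguments do not affect the set of equivalence classes.\<close>

definition geodesic_ray :: "(real \<Rightarrow> 'a::metric_space) \<Rightarrow> bool" where
  "geodesic_ray \<gamma> \<longleftrightarrow> isometric_on {0..} \<gamma>"

definition asymptotic :: "((real \<Rightarrow> 'a::metric_space) \<times> (real \<Rightarrow> 'a)) set" where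
  "asymptotic = {(\<gamma>, \<sigma>). geodesic_ray \<gamma> \<and> geodesic_ray \<sigma> \<and> (\<exists>B. \<forall>t\<ge>0. dist (\<gamma> t) (\<sigma> t) \<le> B)}"

definition gromov_boundary :: "(real \<Rightarrow> 'a::metric_space) set set" where
  "gromov_boundary = Collect geodesic_ray // asymptotic"

definition vertex :: "(real \<Rightarrow> 'a::metric_space) \<Rightarrow> (real \<Rightarrow> 'a) set" where
  "vertex \<gamma> = asymptotic `` {\<gamma>}"

text \<open>The set underlying the compactification is the disjoint union of \<open>X\<close> and its boundary.\<close>

type_synonym 'a gromov_point = "'a + (real \<Rightarrow> 'a) set"

definition gromov_points :: "'a::metric_space gromov_point set" where
  "gromov_points = range Inl \<union> Inr ` gromov_boundary"

text \<open>The topology is that of Bridson and Haefliger, Definition III.H.3.5.  A generalised ray is a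
  geodesic on \<open>[0,R]\<close>, continued by the constant \<open>c R\<close>, or on \<open>[0,\<infinity>)\<close>.
  \<open>generalised_ray c \<xi>\<close> says that \<open>c\<close> is such a ray with endpoint \<open>c(\<infinity>) = \<xi>\<close>.\<close>

fun generalised_ray :: "(real \<Rightarrow> 'a::metric_space) \<Rightarrow> 'a gromov_point \<Rightarrow> bool" where
  "generalised_ray c (Inl x) \<longleftrightarrow> (\<exists>R\<ge>0. isometric_on {0..R} c \<and> (\<forall>t\<ge>R. c t = x))"
| "generalised_ray c (Inr \<xi>) \<longleftrightarrow> geodesic_ray c \<and> vertex c = \<xi>"

definition gromov_converges ::
    "'a::metric_space \<Rightarrow> (nat \<Rightarrow> 'a gromov_point) \<Rightarrow> 'a gromov_point \<Rightarrow> bool" where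
  "gromov_converges b x l \<longleftrightarrow>
     (\<exists>c. (\<forall>n. generalised_ray (c n) (x n) \<and> c n 0 = b) \<and>
          (\<forall>r. strict_mono (r::nat \<Rightarrow> nat) \<longrightarrow>
             (\<exists>s c'. strict_mono (s::nat \<Rightarrow> nat) \<and> generalised_ray c' l \<and>
                (\<forall>T. uniform_limit {0..T} (\<lambda>n. c (r (s n))) c' sequentially))))"

text \<open>The closed sets are the sequentially closed ones.  In a proper geodesic hyperbolic space
  the topology does not depend on the base point \<open>b\<close>.\<close>

definition gromov_closed :: "'a::metric_space \<Rightarrow> 'a gromov_point set \<Rightarrow> bool" where
  "gromov_closed b B \<longleftrightarrow> B \<subseteq> gromov_points \<and>
     (\<forall>x l. (\<forall>n. x n \<in> B) \<and> l \<in> gromov_points \<and> gromov_converges b x l \<longrightarrow> l \<in> B)"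

definition gromov_compactification :: "'a::metric_space \<Rightarrow> 'a gromov_point topology" where
  "gromov_compactification b =
     topology (\<lambda>U. U \<subseteq> gromov_points \<and> gromov_closed b (gromov_points - U))"

lemma gromov_converges_subseq:
  assumes "gromov_converges b x l" "strict_mono r"
  shows "gromov_converges b (x \<circ> r) l"
proof -
  from assms(1) obtain c where
    c: "\<And>n. generalised_ray (c n) (x n) \<and> c n 0 = b"
    and sub: "\<And>q. strict_mono (q::nat \<Rightarrow> nat) \<Longrightarrow>
             \<exists>s c'. strict_mono (s::nat \<Rightarrow> nat) \<and> generalised_ray c' l \<and>
                (\<forall>T. uniform_limit {0..T} (\<lambda>n. c (q (s n))) c' sequentially)"
    unfolding gromov_converges_def by blast
  have "\<exists>s c'. strict_mono (s::nat \<Rightarrow> nat) \<and> generalised_ray c' l \<and>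
                (\<forall>T. uniform_limit {0..T} (\<lambda>n. (c \<circ> r) (q (s n))) c' sequentially)"
    if "strict_mono q" for q :: "nat \<Rightarrow> nat"
    using sub[OF strict_mono_o[OF assms(2) that]] by (simp add: o_def)
  then show ?thesis
    unfolding gromov_converges_def using c by (intro exI[of _ "c \<circ> r"]) auto
qed

lemma gromov_closed_Un:
  assumes "gromov_closed b A" "gromov_closed b B"
  shows "gromov_closed b (A \<union> B)"
  unfolding gromov_closed_def
proof (intro conjI allI impI)
  show "A \<union> B \<subseteq> gromov_points"
    using assms by (auto simp: gromov_closed_def)
  fix x l
  assume *: "(\<forall>n. x n \<in> A \<union> B) \<and> l \<in> gromov_points \<and> gromov_converges b x l"
  have "infinite {n. x n \<in> A} \<or> infinite {n. x n \<in> B}"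
  proof (rule ccontr)
    assume "\<not> ?thesis"
    then have "finite ({n. x n \<in> A} \<union> {n. x n \<in> B})" by simp
    moreover have "{n. x n \<in> A} \<union> {n. x n \<in> B} = UNIV" using * by auto
    ultimately show False by simp
  qed
  then show "l \<in> A \<union> B"
  proof
    assume inf: "infinite {n. x n \<in> A}"
    from infinite_enumerate[OF inf]
    obtain r :: "nat \<Rightarrow> nat" where "strict_mono r" "\<forall>n. r n \<in> {n. x n \<in> A}" by auto
    then show ?thesis
      using gromov_converges_subseq[of b x l r] * assms(1) unfolding gromov_closed_def
      by (metis UnI1 comp_apply mem_Collect_eq)
  next
    assume inf: "infinite {n. x n \<in> B}"
    from infinite_enumerate[OF inf]
    obtain r :: "nat \<Rightarrow> nat" where "strict_mono r" "\<forall>n. r n \<in> {n. x n \<in> B}" by auto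
    then show ?thesis
      using gromov_converges_subseq[of b x l r] * assms(2) unfolding gromov_closed_def
      by (metis UnI2 comp_apply mem_Collect_eq)
  qed
qed

lemma openin_gromov_compactification:
  "openin (gromov_compactification b) U \<longleftrightarrow>
     U \<subseteq> gromov_points \<and> gromov_closed b (gromov_points - U)"
proof -
  have "istopology (\<lambda>U. U \<subseteq> gromov_points \<and> gromov_closed b (gromov_points - U))"
    unfolding istopology_def
  proof (intro conjI allI impI)
    fix S T :: "'a gromov_point set"
    assume S: "S \<subseteq> gromov_points \<and> gromov_closed b (gromov_points - S)"
      and T: "T \<subseteq> gromov_points \<and> gromov_closed b (gromov_points - T)"
    show "S \<inter> T \<subseteq> gromov_points" using S by auto
    show "gromov_closed b (gromov_points - S \<inter> T)"
      unfolding Diff_Int using S T gromov_closed_Un by blast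
  next
    fix K :: "'a gromov_point set set"
    assume K: "\<forall>S\<in>K. S \<subseteq> gromov_points \<and> gromov_closed b (gromov_points - S)"
    then show "\<Union> K \<subseteq> gromov_points" by auto
    show "gromov_closed b (gromov_points - \<Union> K)"
      unfolding gromov_closed_def
    proof (intro conjI allI impI)
      fix x l
      assume *: "(\<forall>n. x n \<in> gromov_points - \<Union> K) \<and> l \<in> gromov_points \<and> gromov_converges b x l"
      have "l \<notin> S" if "S \<in> K" for S
      proof -
        have "\<forall>n. x n \<in> gromov_points - S" using * that by auto
        then show ?thesis using K that * unfolding gromov_closed_def by blast
      qed
      then show "l \<in> gromov_points - \<Union> K" using * by auto
    qed auto
  qed
  then show ?thesis
    by (simp add: gromov_compactification_def topology_inverse')
qed

lemma topspace_gromov_compactification: "topspace (gromov_compactification b) = gromov_points"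
proof
  show "topspace (gromov_compactification b) \<subseteq> gromov_points"
    by (rule conjunct1[OF iffD1[OF openin_gromov_compactification openin_topspace]])
  have "openin (gromov_compactification b) gromov_points"
    by (simp add: openin_gromov_compactification gromov_closed_def)
  then show "gromov_points \<subseteq> topspace (gromov_compactification b)"
    by (rule openin_subset)
qed


section \<open>The horofunction compactification\<close>

definition cont_functions :: "('a::metric_space \<Rightarrow> real) set" where
  "cont_functions = {h. continuous_on UNIV h}"

text \<open>\<open>C(X)\<close> with the topology of uniform convergence on compacta.\<close>

definition ucc_topology :: "('a::metric_space \<Rightarrow> real) topology" where
  "ucc_topology =
     topology (\<lambda>U. U \<subseteq> cont_functions \<and>
       (\<forall>h\<in>U. \<exists>K e. compact K \<and> e > 0 \<and>
          {g \<in> cont_functions. \<forall>y\<in>K. \<bar>g y - h y\<bar> < e} \<subseteq> U))"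

lemma openin_ucc_topology:
  "openin ucc_topology U \<longleftrightarrow>
     U \<subseteq> cont_functions \<and>
       (\<forall>h\<in>U. \<exists>K e. compact K \<and> e > 0 \<and>
          {g \<in> cont_functions. \<forall>y\<in>K. \<bar>g y - h y\<bar> < e} \<subseteq> U)"
proof -
  have "istopology (\<lambda>U::('a \<Rightarrow> real) set. U \<subseteq> cont_functions \<and>
       (\<forall>h\<in>U. \<exists>K e. compact K \<and> e > 0 \<and>
          {g \<in> cont_functions. \<forall>y\<in>K. \<bar>g y - h y\<bar> < e} \<subseteq> U))" (is "istopology ?P")
    unfolding istopology_def
  proof (intro conjI allI impI ballI)
    fix S T :: "('a \<Rightarrow> real) set"
    assume S: "?P S" and T: "?P T"
    show "S \<inter> T \<subseteq> cont_functions" using S by auto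
    fix h assume h: "h \<in> S \<inter> T"
    from S h obtain K e where
      K: "compact K" "e > 0" "{g \<in> cont_functions. \<forall>y\<in>K. \<bar>g y - h y\<bar> < e} \<subseteq> S" by blast
    from T h obtain L d where
      L: "compact L" "d > 0" "{g \<in> cont_functions. \<forall>y\<in>L. \<bar>g y - h y\<bar> < d} \<subseteq> T" by blast
    have "{g \<in> cont_functions. \<forall>y\<in>K \<union> L. \<bar>g y - h y\<bar> < min e d} \<subseteq> S \<inter> T"
      using K(3) L(3) by auto
    with K L show "\<exists>K e. compact K \<and> e > 0 \<and>
          {g \<in> cont_functions. \<forall>y\<in>K. \<bar>g y - h y\<bar> < e} \<subseteq> S \<inter> T"
      by (intro exI[of _ "K \<union> L"] exI[of _ "min e d"]) (simp add: compact_Un)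
  next
    fix \<K> :: "('a \<Rightarrow> real) set set"
    assume \<K>: "\<forall>S\<in>\<K>. ?P S"
    then show "\<Union>\<K> \<subseteq> cont_functions" by auto
    fix h assume "h \<in> \<Union>\<K>"
    then obtain S where S: "S \<in> \<K>" "h \<in> S" by blast
    from \<K> S(1) have "?P S" by (rule bspec)
    with S(2) obtain K e where
      "compact K" "e > 0" "{g \<in> cont_functions. \<forall>y\<in>K. \<bar>g y - h y\<bar> < e} \<subseteq> S" by blast
    with S(1) show "\<exists>K e. compact K \<and> e > 0 \<and>
          {g \<in> cont_functions. \<forall>y\<in>K. \<bar>g y - h y\<bar> < e} \<subseteq> \<Union>\<K>"
      by (intro exI[of _ K] exI[of _ e]) blast
  qed
  then show ?thesis
    by (simp add: ucc_topology_def topology_inverse')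
qed

lemma topspace_ucc_topology: "topspace ucc_topology = cont_functions"
proof
  show "topspace ucc_topology \<subseteq> (cont_functions :: ('a \<Rightarrow> real) set)"
    by (rule conjunct1[OF iffD1[OF openin_ucc_topology openin_topspace]])
  have "openin ucc_topology (cont_functions :: ('a \<Rightarrow> real) set)"
    unfolding openin_ucc_topology by (auto intro!: exI[of _ "{}"] exI[of _ "1::real"])
  then show "(cont_functions :: ('a \<Rightarrow> real) set) \<subseteq> topspace ucc_topology"
    by (rule openin_subset)
qed

definition class_mod_const :: "('a::metric_space \<Rightarrow> real) \<Rightarrow> ('a \<Rightarrow> real) set" where
  "class_mod_const h = {g. \<exists>c. \<forall>y. g y = h y + c}"

text \<open>The quotient topology on \<open>C(X)\<close> modulo constants.\<close>

definition quotient_ucc_topology :: "('a::metric_space \<Rightarrow> real) set topology" where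
  "quotient_ucc_topology =
     topology (\<lambda>U. U \<subseteq> class_mod_const ` cont_functions \<and>
       openin ucc_topology {h \<in> cont_functions. class_mod_const h \<in> U})"

lemma openin_quotient_ucc_topology:
  "openin quotient_ucc_topology U \<longleftrightarrow>
     U \<subseteq> class_mod_const ` cont_functions \<and>
       openin ucc_topology {h \<in> cont_functions. class_mod_const h \<in> U}"
proof -
  have "istopology (\<lambda>U::('a \<Rightarrow> real) set set. U \<subseteq> class_mod_const ` cont_functions \<and>
       openin ucc_topology {h \<in> cont_functions. class_mod_const h \<in> U})" (is "istopology ?P")
    unfolding istopology_def
  proof (intro conjI allI impI)
    fix S T :: "('a \<Rightarrow> real) set set"
    assume S: "?P S" and T: "?P T"
    show "S \<inter> T \<subseteq> class_mod_const ` cont_functions" using S by auto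
    have "{h \<in> cont_functions. class_mod_const h \<in> S \<inter> T} =
        {h \<in> cont_functions. class_mod_const h \<in> S} \<inter> {h \<in> cont_functions. class_mod_const h \<in> T}"
      by auto
    then show "openin ucc_topology {h \<in> cont_functions. class_mod_const h \<in> S \<inter> T}"
      using S T by auto
  next
    fix \<K> :: "('a \<Rightarrow> real) set set set"
    assume \<K>: "\<forall>S\<in>\<K>. ?P S"
    then show "\<Union>\<K> \<subseteq> class_mod_const ` cont_functions" by auto
    have "{h \<in> cont_functions. class_mod_const h \<in> \<Union>\<K>} =
        (\<Union>S\<in>\<K>. {h \<in> cont_functions. class_mod_const h \<in> S})"
      by auto
    then show "openin ucc_topology {h \<in> cont_functions. class_mod_const h \<in> \<Union>\<K>}"
      using \<K> by auto
  qed
  then show ?thesis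
    by (simp add: quotient_ucc_topology_def topology_inverse')
qed

lemma topspace_quotient_ucc_topology:
  "topspace quotient_ucc_topology = class_mod_const ` cont_functions"
proof
  show "topspace quotient_ucc_topology \<subseteq> class_mod_const ` (cont_functions :: ('a \<Rightarrow> real) set)"
    by (rule conjunct1[OF iffD1[OF openin_quotient_ucc_topology openin_topspace]])
  have "{h \<in> cont_functions. class_mod_const h \<in> class_mod_const ` cont_functions} =
      topspace (ucc_topology :: ('a \<Rightarrow> real) topology)"
    unfolding topspace_ucc_topology by auto
  then have "openin quotient_ucc_topology (class_mod_const ` (cont_functions :: ('a \<Rightarrow> real) set))"
    unfolding openin_quotient_ucc_topology using openin_topspace by auto
  then show "class_mod_const ` (cont_functions :: ('a \<Rightarrow> real) set) \<subseteq> topspace quotient_ucc_topology"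
    by (rule openin_subset)
qed

lemma quotient_map_class_mod_const: "quotient_map ucc_topology quotient_ucc_topology class_mod_const"
  unfolding quotient_map_def topspace_ucc_topology topspace_quotient_ucc_topology
    openin_quotient_ucc_topology by auto

definition horo_embedding :: "'a::metric_space \<Rightarrow> ('a \<Rightarrow> real) set" where
  "horo_embedding x = class_mod_const (\<lambda>y. dist x y)"

definition horofunction_compactification :: "('a::metric_space \<Rightarrow> real) set topology" where
  "horofunction_compactification =
     subtopology quotient_ucc_topology (quotient_ucc_topology closure_of range horo_embedding)"

definition compactifications_equivalent :: "'a::metric_space \<Rightarrow> bool" where
  "compactifications_equivalent b \<longleftrightarrow>
     (\<exists>\<Phi>. homeomorphic_map horofunction_compactification (gromov_compactification b) \<Phi> \<and>
          (\<forall>x. \<Phi> (horo_embedding x) = Inl x))"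


section \<open>Dilation and boundary regular fixed points\<close>

text \<open>The filter of points \<open>z\<close> of \<open>X\<close> tending to the boundary point \<open>\<eta>\<close>.\<close>

definition to_boundary :: "'a::metric_space \<Rightarrow> (real \<Rightarrow> 'a) set \<Rightarrow> 'a filter" where
  "to_boundary b \<eta> = filtercomap Inl (nhdsin (gromov_compactification b) (Inr \<eta>))"

definition log_dilation ::
    "'a::metric_space \<Rightarrow> (real \<Rightarrow> 'a) set \<Rightarrow> 'a \<Rightarrow> ('a \<Rightarrow> 'a) \<Rightarrow> ereal" where
  "log_dilation b \<eta> p g = Liminf (to_boundary b \<eta>) (\<lambda>z. ereal (dist z p - dist (g z) p))"

definition exp_ereal :: "ereal \<Rightarrow> ennreal" where
  "exp_ereal a = (case a of ereal r \<Rightarrow> ennreal (exp r) | PInfty \<Rightarrow> \<infinity> | MInfty \<Rightarrow> 0)"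

definition dilation ::
    "'a::metric_space \<Rightarrow> (real \<Rightarrow> 'a) set \<Rightarrow> 'a \<Rightarrow> ('a \<Rightarrow> 'a) \<Rightarrow> ennreal" where
  "dilation b \<eta> p g = exp_ereal (log_dilation b \<eta> p g)"

definition geodesic_region :: "(real \<Rightarrow> 'a::metric_space) \<Rightarrow> real \<Rightarrow> 'a set" where
  "geodesic_region \<gamma> R = neighborhood (\<gamma> ` {0..}) R"

definition has_geodesic_limit ::
    "'a::metric_space \<Rightarrow> ('a \<Rightarrow> 'a) \<Rightarrow> 'a gromov_point \<Rightarrow> (real \<Rightarrow> 'a) set \<Rightarrow> bool" where
  "has_geodesic_limit b g \<xi> \<eta> \<longleftrightarrow>
     (\<forall>\<gamma> R x. geodesic_ray \<gamma> \<and> vertex \<gamma> = \<eta> \<and> R > 0 \<and>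
        (\<forall>n. x n \<in> geodesic_region \<gamma> R) \<and>
        limitin (gromov_compactification b) (\<lambda>n. Inl (x n)) (Inr \<eta>) sequentially \<longrightarrow>
        limitin (gromov_compactification b) (\<lambda>n. Inl (g (x n))) \<xi> sequentially)"

text \<open>For non-expanding \<open>g\<close>, finiteness of the dilation does not depend on \<open>p\<close>, because
  replacing \<open>p\<close> by \<open>q\<close> changes the argument of the limit inferior by at most \<open>2 * dist p q\<close>.\<close>

definition boundary_regular_fixed_point ::
    "'a::metric_space \<Rightarrow> ('a \<Rightarrow> 'a) \<Rightarrow> (real \<Rightarrow> 'a) set \<Rightarrow> bool" where
  "boundary_regular_fixed_point b g \<eta> \<longleftrightarrow>
     \<eta> \<in> gromov_boundary \<and> (\<exists>p. dilation b \<eta> p g < \<infinity>) \<and> has_geodesic_limit b g (Inr \<eta>) \<eta>"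

end

theory Submission
  imports Defs "HOL-Library.Diagonal_Subsequence"
begin

text \<open>Let \<open>h\<close> be the horofunction at \<open>\<eta>\<close>, so that \<open>d(z,x) - d(z,q) \<rightarrow> h x - h q\<close> as \<open>z \<rightarrow> \<eta>\<close>.
  The key point is that \<open>f z \<rightarrow> \<eta>\<close> when \<open>z \<rightarrow> \<eta>\<close> along points where the drop \<open>d(z,p) - d(f z,p)\<close> is
  bounded above.  Passing to the limit along points whose drop tends to \<open>log \<lambda>\<close>, we get
  \<open>h (f x) \<le> h x + log \<lambda>\<close> for all \<open>x\<close>.  Iterating this along a ray \<open>\<gamma>\<close> with vertex \<open>\<eta>\<close>, where
  \<open>d(\<gamma> t,p) + h (\<gamma> t) - h p \<rightarrow> 0\<close>, gives \<open>\<lambda>(f\<^sup>n) \<le> \<lambda>(f)\<^sup>n\<close>.  Conversely, the drop of \<open>f\<^sup>n\<close> at \<open>z\<close> is the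
  sum of the drops of \<open>f\<close> at \<open>z, f z, \<dots>, f\<^sup>n\<^sup>-\<^sup>1 z\<close>.  If it is bounded above, then so is each summand,
  hence all these points tend to \<open>\<eta>\<close> and every summand has limit inferior at least \<open>log \<lambda>\<close>.\<close>

section \<open>Generalised rays and thin triangles\<close>

lemma geodesic_segment_commute:
  assumes "geodesic_segment S x y"
  shows "geodesic_segment S y x"
proof -
  define d where "d = dist x y"
  from assms obtain c where c: "isometric_on {0..d} c" "c 0 = x" "c d = y" "S = c ` {0..d}"
    unfolding geodesic_segment_def d_def by blast
  have d: "d \<ge> 0" "dist y x = d" by (simp_all add: d_def dist_commute)
  have refl: "(\<lambda>t. d - t) ` {0..d} = {0..d}"
    by (auto intro!: image_eqI[of _ _ "d - _"])
  have "S = (\<lambda>t. c (d - t)) ` {0..d}"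
    by (metis (no_types) refl c(4) image_image)
  moreover have "isometric_on {0..d} (\<lambda>t. c (d - t))"
    using c(1) by (auto simp: isometric_on_def)
  ultimately show ?thesis
    unfolding geodesic_segment_def d(2) using c(2,3)
    by (intro exI[of _ "\<lambda>t. c (d - t)"]) auto
qed

text \<open>The length \<open>R\<close> is hidden behind an existential quantifier; evaluating the
  isometry at \<open>0\<close> and \<open>R\<close> forces \<open>R = dist b x\<close>.\<close>

lemma generalised_ray_endpoint:
  assumes "generalised_ray c (Inl x)" "c 0 = b"
  shows "isometric_on {0..dist b x} c" and "t \<ge> dist b x \<Longrightarrow> c t = x"
proof -
  from assms(1) obtain R where R: "R \<ge> 0" "isometric_on {0..R} c" "\<And>t. t \<ge> R \<Longrightarrow> c t = x"
    by auto
  have "dist (c 0) (c R) = R"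
    using R(1,2) by (auto simp: isometric_on_def)
  then have "dist b x = R" using assms(2) R(3)[of R] by simp
  with R show "isometric_on {0..dist b x} c" "t \<ge> dist b x \<Longrightarrow> c t = x" by simp_all
qed

lemma generalised_ray_segment:
  assumes "generalised_ray c (Inl x)" "c 0 = b"
  shows "geodesic_segment (c ` {0..dist b x}) b x"
  unfolding geodesic_segment_def
  using generalised_ray_endpoint(1)[OF assms] generalised_ray_endpoint(2)[OF assms, of "dist b x"] assms(2)
  by (intro exI[of _ c]) simp

text \<open>The constant continuation amounts to clamping the parameter at \<open>dist b x\<close>.
  In particular such a ray is 1-Lipschitz on the whole half-line, which the compactness argument
  below relies on.\<close>

lemma generalised_ray_dist:
  assumes "generalised_ray c (Inl x)" "c 0 = b" "s \<ge> 0" "t \<ge> 0"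
  shows "dist (c s) (c t) = \<bar>min s (dist b x) - min t (dist b x)\<bar>"
proof -
  have "c u = c (min u (dist b x))" for u
    using generalised_ray_endpoint(2)[OF assms(1,2), of u]
      generalised_ray_endpoint(2)[OF assms(1,2), of "dist b x"]
    by (cases "u \<le> dist b x") (auto simp: min_def)
  then have "dist (c s) (c t) = dist (c (min s (dist b x))) (c (min t (dist b x)))"
    by metis
  also have "\<dots> = \<bar>min s (dist b x) - min t (dist b x)\<bar>"
    using generalised_ray_endpoint(1)[OF assms(1,2)] assms(3,4) by (simp add: isometric_on_def)
  finally show ?thesis .
qed

lemma generalised_ray_exists:
  fixes b :: "'a::metric_space"
  assumes "geodesic_space TYPE('a)"
  obtains c where "generalised_ray c (Inl x)" "c 0 = b"
proof -
  from assms obtain S where "geodesic_segment S b x" unfolding geodesic_space_def by blast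
  then obtain c where c: "isometric_on {0..dist b x} c" "c 0 = b" "c (dist b x) = x"
    unfolding geodesic_segment_def by blast
  show ?thesis
  proof
    show "generalised_ray (\<lambda>t. if t \<le> dist b x then c t else x) (Inl x)"
      unfolding generalised_ray.simps
      using c by (intro exI[of _ "dist b x"]) (auto simp: isometric_on_def)
  qed (use c in auto)
qed

section \<open>Geodesic rays and their vertices\<close>

lemma geodesic_ray_dist:
  "geodesic_ray \<gamma> \<Longrightarrow> s \<ge> 0 \<Longrightarrow> t \<ge> 0 \<Longrightarrow> dist (\<gamma> s) (\<gamma> t) = \<bar>s - t\<bar>"
  by (simp add: geodesic_ray_def isometric_on_def)

lemma geodesic_ray_segment:
  assumes "geodesic_ray \<gamma>" "s \<ge> 0"
  shows "geodesic_segment (\<gamma> ` {0..s}) (\<gamma> 0) (\<gamma> s)"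
  unfolding geodesic_segment_def
  using assms geodesic_ray_dist[OF assms(1), of 0 s]
  by (intro exI[of _ \<gamma>]) (auto simp: geodesic_ray_def isometric_on_def)

lemma asymptotic_equiv:
  "equiv (Collect geodesic_ray) (asymptotic :: ((real \<Rightarrow> 'a::metric_space) \<times> (real \<Rightarrow> 'a)) set)"
proof (rule equivI)
  show "(asymptotic :: ((real \<Rightarrow> 'a) \<times> (real \<Rightarrow> 'a)) set) \<subseteq> Collect geodesic_ray \<times> Collect geodesic_ray"
    by (auto simp: asymptotic_def)
  show "refl_on (Collect geodesic_ray) (asymptotic :: ((real \<Rightarrow> 'a) \<times> (real \<Rightarrow> 'a)) set)"
    by (auto simp: refl_on_def asymptotic_def)
  show "sym (asymptotic :: ((real \<Rightarrow> 'a) \<times> (real \<Rightarrow> 'a)) set)" by (auto simp: sym_def asymptotic_def dist_commute)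
  show "trans (asymptotic :: ((real \<Rightarrow> 'a) \<times> (real \<Rightarrow> 'a)) set)"
  proof (rule transI)
    fix \<gamma> \<sigma> \<tau> :: "real \<Rightarrow> 'a"
    assume *: "(\<gamma>, \<sigma>) \<in> asymptotic" "(\<sigma>, \<tau>) \<in> asymptotic"
    then obtain B C where "\<forall>t\<ge>0. dist (\<gamma> t) (\<sigma> t) \<le> B" "\<forall>t\<ge>0. dist (\<sigma> t) (\<tau> t) \<le> C"
      by (auto simp: asymptotic_def)
    then have "\<forall>t\<ge>0. dist (\<gamma> t) (\<tau> t) \<le> B + C"
      by (metis add_mono dist_triangle order_trans)
    then show "(\<gamma>, \<tau>) \<in> asymptotic"
      using * by (auto simp: asymptotic_def)
  qed
qed

lemma vertex_eqI:
  assumes "geodesic_ray \<gamma>" "geodesic_ray \<sigma>" "\<And>t. t \<ge> 0 \<Longrightarrow> dist (\<gamma> t) (\<sigma> t) \<le> B"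
  shows "vertex \<gamma> = vertex \<sigma>"
  unfolding vertex_def
  by (rule equiv_class_eq[OF asymptotic_equiv]) (use assms in \<open>auto simp: asymptotic_def\<close>)

lemma vertex_in_boundary: "geodesic_ray \<gamma> \<Longrightarrow> vertex \<gamma> \<in> gromov_boundary"
  by (simp add: gromov_boundary_def vertex_def quotientI)

lemma gromov_boundaryE:
  assumes "\<eta> \<in> gromov_boundary"
  obtains \<gamma> where "geodesic_ray \<gamma>" "vertex \<gamma> = \<eta>"
  using assms by (auto simp: gromov_boundary_def vertex_def elim!: quotientE)

text \<open>Fixes one hyperbolicity constant and replaces neighborhoods by actual nearby points.
  Stating the condition for the side \<open>A\<close> covers the other two sides by cyclic
  relabelling.\<close>

locale thin_triangles =
  fixes \<delta> :: real
  assumes geodesic: "geodesic_space TYPE('a::metric_space)"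
    and thin: "\<And>x y z A B C u. geodesic_segment A x y \<Longrightarrow> geodesic_segment B y z \<Longrightarrow>
       geodesic_segment C z (x::'a) \<Longrightarrow> u \<in> A \<Longrightarrow> \<exists>v\<in>B \<union> C. dist u v < \<delta>"

lemma thin_trianglesE:
  assumes "geodesic_space TYPE('a::metric_space)" "gromov_hyperbolic TYPE('a)"
  obtains \<delta> where "thin_triangles TYPE('a) \<delta>"
proof -
  obtain \<delta> where \<delta>: "\<forall>(x::'a) y z A B C.
        geodesic_segment A x y \<and> geodesic_segment B y z \<and> geodesic_segment C z x \<longrightarrow>
          A \<subseteq> neighborhood (B \<union> C) \<delta> \<and>
          B \<subseteq> neighborhood (C \<union> A) \<delta> \<and>
          C \<subseteq> neighborhood (A \<union> B) \<delta>"
    using assms(2) unfolding gromov_hyperbolic_def by (elim exE conjE)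
  have "thin_triangles TYPE('a) \<delta>"
  proof
    fix x y z :: 'a and A B C u
    assume *: "geodesic_segment A x y" "geodesic_segment B y z" "geodesic_segment C z x" "u \<in> A"
    \<comment> \<open>By convention \<open>infdist\<close> to the empty set is \<open>0\<close>, so
      nonemptiness is needed to read it as an infimum. Strictness of the bound then yields a witness
      even though the infimum may not be attained.\<close>
    have "B \<noteq> {}" using *(2) by (auto simp: geodesic_segment_def)
    then have ne: "B \<union> C \<noteq> {}" by simp
    have "infdist u (B \<union> C) < \<delta>" using \<delta>[rule_format, OF conjI[OF *(1) conjI[OF *(2,3)]]] *(4)
      by (auto simp: neighborhood_def)
    then show "\<exists>v\<in>B \<union> C. dist u v < \<delta>"
      unfolding infdist_notempty[OF ne] by (subst (asm) cINF_less_iff) (use ne in auto)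
  qed (fact assms(1))
  then show ?thesis by (rule that)
qed

context thin_triangles
begin

lemma segment_exists: obtains S where "geodesic_segment S (x::'a) y"
  using geodesic unfolding geodesic_space_def by blast

text \<open>The hypothesis on \<open>t\<close> says that the Gromov product of \<open>y\<close> and \<open>w\<close> at \<open>b\<close> is at least
  \<open>t + \<delta>\<close>: every point of a geodesic from \<open>y\<close> to \<open>w\<close> is then at distance at least \<open>t + \<delta>\<close>
  from \<open>b\<close>, so the point \<open>c t\<close> must be close to the third side.\<close>

lemma fellow_travel:
  fixes b y w :: 'a
  assumes c: "generalised_ray c (Inl y)" "c 0 = b" and e: "generalised_ray e (Inl w)" "e 0 = b"
    and t: "0 \<le> t" "2 * (t + \<delta>) \<le> dist b y + dist b w - dist y w"
  shows "dist (c t) (e t) \<le> 2 * \<delta>"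
proof -
  obtain S where S: "geodesic_segment S y w" by (rule segment_exists)
  \<comment> \<open>Positivity is read off from the degenerate triangle with all vertices at
    \<open>b\<close>.\<close>
  have \<delta>: "\<delta> > 0"
  proof -
    obtain A where A: "geodesic_segment A b b" by (rule segment_exists)
    then obtain u where "u \<in> A" by (auto simp: geodesic_segment_def)
    with thin[OF A A A] obtain v where "dist u v < \<delta>" by blast
    then show ?thesis using zero_le_dist[of u v] by linarith
  qed
  have tri: "dist b y \<le> dist b w + dist y w" "dist b w \<le> dist b y + dist y w"
    using dist_triangle[of b y w] dist_triangle[of b w y] by (simp_all add: dist_commute)
  have ty: "t \<le> dist b y" using t(2) tri \<delta> by argo
  have tw: "t \<le> dist b w" using t(2) tri \<delta> by argo
  have ct: "dist b (c t) = t"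
    using generalised_ray_dist[OF c, of 0 t] t(1) ty c(2) by simp
  have "c t \<in> c ` {0..dist b y}" using t(1) ty by simp
  from thin[OF generalised_ray_segment[OF c] S geodesic_segment_commute[OF generalised_ray_segment[OF e]] this]
  obtain v where v: "v \<in> S \<union> e ` {0..dist b w}" "dist (c t) v < \<delta>" by blast
  have "v \<notin> S"
  proof
    assume "v \<in> S"
    then obtain k s where k: "isometric_on {0..dist y w} k" "k 0 = y" "k (dist y w) = w"
      "v = k s" "0 \<le> s" "s \<le> dist y w"
      using S unfolding geodesic_segment_def by auto
    have "dist (k 0) (k s) = s" "dist (k s) (k (dist y w)) = dist y w - s"
      using k(1,5,6) by (auto simp: isometric_on_def)
    then have "dist y v + dist v w = dist y w" using k by simp
    moreover have "dist b y \<le> dist b v + dist y v" "dist b w \<le> dist b v + dist v w"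
      using dist_triangle[of b y v] dist_triangle[of b w v] by (simp_all add: dist_commute)
    moreover have "dist b v \<le> t + dist (c t) v" using dist_triangle[of b v "c t"] ct by simp
    ultimately show False using t(2) v(2) by argo
  qed
  with v obtain s where s: "v = e s" "0 \<le> s" "s \<le> dist b w" by auto
  \<comment> \<open>Comparing distances to \<open>b\<close> shows that \<open>s\<close> and
    \<open>t\<close> differ by less than \<delta>, so sliding from \<open>e s\<close> to
    \<open>e t\<close> costs at most one more \<delta>.\<close>
  have "dist b v = s" "dist v (e t) = \<bar>s - t\<bar>"
    using generalised_ray_dist[OF e, of 0 s] generalised_ray_dist[OF e, of s t] s t(1) tw e(2) by auto
  moreover have "dist b v \<le> dist b (c t) + dist (c t) v" "dist b (c t) \<le> dist b v + dist (c t) v"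
    using dist_triangle[of b v "c t"] dist_triangle[of b "c t" v] by (simp_all add: dist_commute)
  moreover have "dist (c t) (e t) \<le> dist (c t) v + dist v (e t)" by (rule dist_triangle)
  ultimately show ?thesis using ct v(2) by linarith
qed

text \<open>Thinness is applied to the triangle \<open>b\<close>, \<open>\<gamma> 0\<close>,
  \<open>\<gamma> s\<close>. If \<open>c t\<close> is close to some \<open>\<gamma> u\<close>, then
  \<open>u\<close> and \<open>t\<close> differ by less than
  \<open>\<delta> + dist b (\<gamma> 0)\<close>. If it is close to the short side from
  \<open>\<gamma> 0\<close> to \<open>b\<close>, then \<open>t\<close> itself is below
  \<open>\<delta> + dist b (\<gamma> 0)\<close>, so everything happens near
  \<open>b\<close>.\<close>

lemma fellow_travel_ray:
  fixes b :: 'a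
  assumes \<gamma>: "geodesic_ray \<gamma>" and s: "s \<ge> 0"
    and c: "generalised_ray c (Inl (\<gamma> s))" "c 0 = b" and t: "0 \<le> t" "t \<le> dist b (\<gamma> s)"
  shows "dist (c t) (\<gamma> t) \<le> 2 * \<delta> + 2 * dist b (\<gamma> 0)"
proof -
  obtain S where S: "geodesic_segment S (\<gamma> 0) b" by (rule segment_exists)
  have ct: "dist b (c t) = t"
    using generalised_ray_dist[OF c, of 0 t] t c(2) by simp
  have "c t \<in> c ` {0..dist b (\<gamma> s)}" using t by simp
  from thin[OF generalised_ray_segment[OF c] geodesic_segment_commute[OF geodesic_ray_segment[OF \<gamma> s]] S this]
  obtain v where v: "v \<in> \<gamma> ` {0..s} \<union> S" "dist (c t) v < \<delta>" by blast
  have tri: "dist b (c t) \<le> dist b v + dist (c t) v" "dist b v \<le> dist b (c t) + dist (c t) v"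
    "dist b v \<le> dist b (\<gamma> 0) + dist (\<gamma> 0) v" "dist (\<gamma> 0) v \<le> dist b (\<gamma> 0) + dist b v"
    "dist (c t) (\<gamma> t) \<le> dist (c t) v + dist v (\<gamma> t)"
    using dist_triangle[of b "c t" v] dist_triangle[of b v "c t"] dist_triangle[of b v "\<gamma> 0"]
      dist_triangle[of "\<gamma> 0" v b] dist_triangle[of "c t" "\<gamma> t" v]
    by (simp_all add: dist_commute)
  from v(1) consider u where "v = \<gamma> u" "0 \<le> u" "u \<le> s" | "v \<in> S" by auto
  then show ?thesis
  proof cases
    case 1
    have "dist (\<gamma> 0) v = u" "dist v (\<gamma> t) = \<bar>u - t\<bar>"
      using geodesic_ray_dist[OF \<gamma>, of 0 u] geodesic_ray_dist[OF \<gamma>, of u t] 1 t by auto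
    with tri ct v(2) zero_le_dist[of b "\<gamma> 0"] show ?thesis by linarith
  next
    case 2
    then obtain k r where k: "isometric_on {0..dist (\<gamma> 0) b} k" "k 0 = \<gamma> 0" "k (dist (\<gamma> 0) b) = b"
      "v = k r" "0 \<le> r" "r \<le> dist (\<gamma> 0) b"
      using S unfolding geodesic_segment_def by auto
    have "dist (k 0) (k r) = r" "dist (k r) (k (dist (\<gamma> 0) b)) = dist (\<gamma> 0) b - r"
      using k(1,5,6) by (auto simp: isometric_on_def)
    then have "dist (\<gamma> 0) v + dist b v = dist b (\<gamma> 0)" using k by (simp add: dist_commute)
    moreover have "dist v (\<gamma> t) \<le> dist (\<gamma> 0) v + t"
      using dist_triangle[of v "\<gamma> t" "\<gamma> 0"] geodesic_ray_dist[OF \<gamma>, of 0 t] t by (simp add: dist_commute)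
    ultimately show ?thesis using tri ct v(2) zero_le_dist[of b v] by linarith
  qed
qed

end


section \<open>Subsequences converging to a geodesic ray\<close>

lemma proper_space_convergent_subseq:
  fixes x :: "nat \<Rightarrow> 'a::metric_space"
  assumes "proper_space TYPE('a)" "\<And>n. dist a (x n) \<le> R"
  obtains r where "strict_mono (r :: nat \<Rightarrow> nat)" "convergent (x \<circ> r)"
proof -
  have "seq_compact (cball a R)"
    using assms(1) by (simp add: proper_space_def compact_imp_seq_compact)
  then obtain l r where "strict_mono (r :: nat \<Rightarrow> nat)" "(x \<circ> r) \<longlonglongrightarrow> l"
    using assms(2) by (auto elim!: seq_compactE[of _ x])
  then show ?thesis using that by (auto simp: convergent_def)
qed

lemma proper_space_Cauchy_convergent:
  fixes x :: "nat \<Rightarrow> 'a::metric_space"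
  assumes "proper_space TYPE('a)" "Cauchy x"
  shows "convergent x"
proof -
  from cauchy_imp_bounded[OF assms(2)] obtain R where "\<And>n. dist (x 0) (x n) \<le> R"
    by (metis bounded_any_center rangeI)
  then obtain r where "strict_mono r" "convergent (x \<circ> r)"
    by (rule proper_space_convergent_subseq[OF assms(1)])
  then show ?thesis
    using Cauchy_converges_subseq[OF assms(2)] unfolding convergent_def by blast
qed

text \<open>The Arzela-Ascoli argument: a diagonal subsequence converges at all nonnegative
  rationals, and the common Lipschitz constant spreads this to all parameters and makes it uniform
  on bounded intervals.\<close>

lemma Lipschitz_subsequence_uniform_limit:
  fixes c :: "nat \<Rightarrow> real \<Rightarrow> 'a::metric_space"
  assumes proper: "proper_space TYPE('a)"
    and lip: "\<And>n s t. s \<ge> 0 \<Longrightarrow> t \<ge> 0 \<Longrightarrow> dist (c n s) (c n t) \<le> \<bar>s - t\<bar>"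
    and start: "\<And>n. c n 0 = b"
  obtains r c' where "strict_mono (r :: nat \<Rightarrow> nat)"
    "\<forall>T. uniform_limit {0..T} (\<lambda>n. c (r n)) c' sequentially"
proof -
  define q where "q = from_nat_into (\<rat> \<inter> {0::real..})"
  have q: "range q = \<rat> \<inter> {0..}"
    unfolding q_def by (rule range_from_nat_into) (auto intro: countable_Int1 countable_rat exI[of _ 0])
  have q0: "q i \<ge> 0" for i using q by (metis IntD2 atLeast_iff rangeI)
  interpret subseqs "\<lambda>i s. convergent (\<lambda>n. c (s n) (q i))"
  proof
    fix i and s :: "nat \<Rightarrow> nat"
    have "dist b (c (s n) (q i)) \<le> q i" for n
      using lip[of 0 "q i" "s n"] start q0 by simp
    from proper_space_convergent_subseq[OF proper this]
    obtain r where "strict_mono r" "convergent ((\<lambda>n. c (s n) (q i)) \<circ> r)" .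
    then show "\<exists>r. strict_mono r \<and> convergent (\<lambda>n. c ((s \<circ> r) n) (q i))"
      by (auto simp: o_def)
  qed
  define r where "r = diagseq"
  have conv_q: "convergent (\<lambda>n. c (r n) (q i))" for i
  proof -
    \<comment> \<open>The diagonal sequence refines the one chosen for \<open>q i\<close> only from
      index \<open>Suc i\<close> on; the initial segment is discarded afterwards.\<close>
    have "convergent (\<lambda>n. c ((diagseq \<circ> (+) (Suc i)) n) (q i))"
    proof (rule diagseq_holds)
      fix u s and k :: nat
      assume "strict_mono (u :: nat \<Rightarrow> nat)" "convergent (\<lambda>n. c (s n) (q k))"
      then show "convergent (\<lambda>n. c ((s \<circ> u) n) (q k))"
        using convergent_subseq_convergent[of "\<lambda>n. c (s n) (q k)" u] by (simp add: o_def)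
    qed
    then have "convergent (\<lambda>n. c (r (n + Suc i)) (q i))"
      by (simp add: r_def o_def add.commute)
    then show ?thesis by (subst (asm) convergent_ignore_initial_segment)
  qed
  have "convergent (\<lambda>n. c (r n) t)" if t: "t \<ge> 0" for t
  proof (rule proper_space_Cauchy_convergent[OF proper], rule metric_CauchyI)
    fix e :: real assume e: "e > 0"
    obtain p where p: "p \<in> \<rat>" "t < p" "p < t + e/3"
      using Rats_dense_in_real[of t "t + e/3"] e by auto
    with t q obtain i where i: "p = q i" by (metis IntI atLeast_iff imageE less_imp_le order_trans)
    from conv_q[of i] obtain M where M: "\<And>m n. m \<ge> M \<Longrightarrow> n \<ge> M \<Longrightarrow> dist (c (r m) p) (c (r n) p) < e/3"
      unfolding i using convergent_Cauchy metric_CauchyD[of _ "e/3"] e by (metis zero_less_divide_iff zero_less_numeral)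
    have "dist (c (r m) t) (c (r n) t) < e" if "m \<ge> M" "n \<ge> M" for m n
    proof -
      have "dist (c (r k) t) (c (r k) p) < e/3" for k
        using lip[of t p "r k"] t p by simp
      from this[of m] this[of n] M[OF that] show ?thesis
        using dist_triangle[of "c (r m) t" "c (r n) t" "c (r m) p"]
          dist_triangle[of "c (r m) p" "c (r n) t" "c (r n) p"]
        by (simp add: dist_commute)
    qed
    then show "\<exists>M. \<forall>m\<ge>M. \<forall>n\<ge>M. dist (c (r m) t) (c (r n) t) < e" by blast
  qed
  then obtain c' where c': "\<And>t. t \<ge> 0 \<Longrightarrow> (\<lambda>n. c (r n) t) \<longlonglongrightarrow> c' t"
    unfolding convergent_def by metis
  have lip': "dist (c' s) (c' t) \<le> \<bar>s - t\<bar>" if "s \<ge> 0" "t \<ge> 0" for s t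
    by (rule tendsto_upperbound[OF tendsto_dist[OF c'[OF that(1)] c'[OF that(2)]]])
       (use that lip in auto)
  have "uniform_limit {0..T} (\<lambda>n. c (r n)) c' sequentially" for T
  proof (rule uniform_limitI)
    fix e :: real assume e: "e > 0"
    \<comment> \<open>Finitely many nodes of mesh \<open>e/3\<close> cover \<open>{0..T}\<close>.
      Convergence at the node just below \<open>t\<close>, and the Lipschitz bounds for
      \<open>c (r n)\<close> and for \<open>c'\<close>, contribute three errors below
      \<open>e/3\<close>.\<close>
    define N where "N = nat \<lceil>T / (e/3)\<rceil>"
    have "\<forall>\<^sub>F n in sequentially. \<forall>k\<in>{..N}. dist (c (r n) (real k * (e/3))) (c' (real k * (e/3))) < e/3"
      using e by (intro eventually_ball_finite ballI tendstoD[OF c']) auto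
    then show "\<forall>\<^sub>F n in sequentially. \<forall>t\<in>{0..T}. dist (c (r n) t) (c' t) < e"
    proof eventually_elim
      case (elim n)
      show ?case
      proof
        fix t assume t: "t \<in> {0..T}"
        define k where "k = nat \<lfloor>t / (e/3)\<rfloor>"
        have "real k = of_int \<lfloor>t / (e/3)\<rfloor>" using t e by (simp add: k_def)
        then have "real k \<le> t / (e/3)" "t / (e/3) < real k + 1" by linarith+
        then have k: "real k * (e/3) \<le> t" "t < real k * (e/3) + e/3"
          using e by (simp_all add: field_simps)
        have "k \<le> N" unfolding k_def N_def
          using t e by (intro nat_mono) (meson atLeastAtMost_iff divide_right_mono floor_le_ceiling floor_mono less_imp_le order_trans zero_le_divide_iff zero_le_numeral)
        with elim have 1: "dist (c (r n) (real k * (e/3))) (c' (real k * (e/3))) < e/3" by simp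
        have 2: "dist (c (r n) t) (c (r n) (real k * (e/3))) < e/3"
          using lip[of t "real k * (e/3)" "r n"] k t e by simp
        have 3: "dist (c' (real k * (e/3))) (c' t) < e/3"
          using lip'[of "real k * (e/3)" t] k t e by simp
        from 1 2 3 show "dist (c (r n) t) (c' t) < e"
          using dist_triangle[of "c (r n) t" "c' t" "c (r n) (real k * (e/3))"]
            dist_triangle[of "c (r n) (real k * (e/3))" "c' t" "c' (real k * (e/3))"] by linarith
      qed
    qed
  qed
  moreover have "strict_mono r" unfolding r_def by (rule subseq_diagseq)
  ultimately show ?thesis using that by blast
qed

text \<open>Since the lengths \<open>dist b (y n)\<close> tend to infinity, any two given parameters
  eventually lie before the clamping point, so the Lipschitz limit is an isometry and not merely
  1-Lipschitz.\<close>

lemma generalised_rays_subsequence: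
  fixes c :: "nat \<Rightarrow> real \<Rightarrow> 'a::metric_space"
  assumes proper: "proper_space TYPE('a)"
    and c: "\<And>n. generalised_ray (c n) (Inl (y n))" "\<And>n. c n 0 = b"
    and y: "filterlim (\<lambda>n. dist b (y n)) at_top sequentially"
  obtains r c' where "strict_mono (r :: nat \<Rightarrow> nat)" "geodesic_ray c'"
    "\<forall>T. uniform_limit {0..T} (\<lambda>n. c (r n)) c' sequentially"
proof -
  have lip: "dist (c n s) (c n t) \<le> \<bar>s - t\<bar>" if "s \<ge> 0" "t \<ge> 0" for n s t
    unfolding generalised_ray_dist[OF c that] by (auto simp: min_def)
  obtain r c' where r: "strict_mono (r :: nat \<Rightarrow> nat)"
    "\<forall>T. uniform_limit {0..T} (\<lambda>n. c (r n)) c' sequentially"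
    by (rule Lipschitz_subsequence_uniform_limit[where c = c, OF proper lip c(2)])
  have lim: "(\<lambda>n. c (r n) t) \<longlonglongrightarrow> c' t" if "t \<ge> 0" for t
    by (rule tendsto_uniform_limitI[OF r(2)[rule_format, of t]]) (use that in simp)
  have "dist (c' s) (c' t) = \<bar>s - t\<bar>" if st: "s \<ge> 0" "t \<ge> 0" for s t
  proof (rule LIMSEQ_unique[OF tendsto_dist[OF lim[OF st(1)] lim[OF st(2)]]])
    have "filterlim (\<lambda>n. dist b (y (r n))) at_top sequentially"
      using filterlim_compose[OF y filterlim_subseq[OF r(1)]] .
    then have "\<forall>\<^sub>F n in sequentially. max s t \<le> dist b (y (r n))"
      unfolding filterlim_at_top by blast
    then have "\<forall>\<^sub>F n in sequentially. dist (c (r n) s) (c (r n) t) = \<bar>s - t\<bar>"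
      by eventually_elim (simp add: generalised_ray_dist[OF c st])
    then show "(\<lambda>n. dist (c (r n) s) (c (r n) t)) \<longlonglongrightarrow> \<bar>s - t\<bar>"
      by (rule tendsto_eventually)
  qed
  then have "geodesic_ray c'" by (simp add: geodesic_ray_def isometric_on_def)
  then show ?thesis by (rule that[OF r(1) _ r(2)])
qed


section \<open>Convergence to boundary points\<close>

lemma limitin_iff_filterlim_nhdsin:
  "limitin X f l F \<longleftrightarrow> l \<in> topspace X \<and> filterlim f (nhdsin X l) F"
proof (cases "l \<in> topspace X")
  case True
  have "filterlim f (nhdsin X l) F \<longleftrightarrow> (\<forall>U. openin X U \<and> l \<in> U \<longrightarrow> (\<forall>\<^sub>F x in F. f x \<in> U))"
  proof
    assume lim: "filterlim f (nhdsin X l) F"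
    show "\<forall>U. openin X U \<and> l \<in> U \<longrightarrow> (\<forall>\<^sub>F x in F. f x \<in> U)"
    proof (intro allI impI)
      fix U assume "openin X U \<and> l \<in> U"
      then have "\<forall>\<^sub>F x in nhdsin X l. x \<in> U" unfolding eventually_nhdsin by blast
      with lim show "\<forall>\<^sub>F x in F. f x \<in> U" by (rule eventually_compose_filterlim[rotated])
    qed
  next
    assume lim: "\<forall>U. openin X U \<and> l \<in> U \<longrightarrow> (\<forall>\<^sub>F x in F. f x \<in> U)"
    show "filterlim f (nhdsin X l) F"
      unfolding filterlim_iff eventually_nhdsin
    proof (intro allI impI)
      fix P assume "l \<notin> topspace X \<or> (\<exists>S. openin X S \<and> l \<in> S \<and> (\<forall>x\<in>S. P x))"
      with True obtain S where S: "openin X S" "l \<in> S" "\<forall>x\<in>S. P x" by blast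
      with lim have "\<forall>\<^sub>F x in F. f x \<in> S" by blast
      then show "\<forall>\<^sub>F x in F. P (f x)" by eventually_elim (use S in blast)
    qed
  qed
  then show ?thesis using True by (simp add: limitin_def)
qed (simp add: limitin_def)

text \<open>Lets topological convergence to \<eta> be handled by composition of filters.\<close>

lemma filterlim_to_boundary_iff:
  assumes "\<eta> \<in> gromov_boundary"
  shows "filterlim y (to_boundary b \<eta>) F \<longleftrightarrow>
    limitin (gromov_compactification b) (\<lambda>n. Inl (y n)) (Inr \<eta>) F"
  using assms
  by (simp add: to_boundary_def filterlim_filtercomap_iff limitin_iff_filterlim_nhdsin o_def
      topspace_gromov_compactification gromov_points_def)

text \<open>A sequence leaving an open \<open>U\<close> infinitely often has a subsequence in the
  complement, which is sequentially closed by definition of the topology and would therefore contain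
  \<open>l\<close>.\<close>

lemma gromov_converges_imp_limitin:
  assumes conv: "gromov_converges b x l" and x: "\<And>n. x n \<in> gromov_points" and l: "l \<in> gromov_points"
  shows "limitin (gromov_compactification b) x l sequentially"
  unfolding limitin_def topspace_gromov_compactification
proof (intro conjI allI impI l)
  fix U assume U: "openin (gromov_compactification b) U \<and> l \<in> U"
  show "\<forall>\<^sub>F n in sequentially. x n \<in> U"
  proof (rule ccontr)
    assume "\<not> ?thesis"
    then have "infinite {n. x n \<notin> U}"
      by (simp add: cofinite_eq_sequentially[symmetric] eventually_cofinite)
    from infinite_enumerate[OF this] obtain r :: "nat \<Rightarrow> nat"
      where r: "strict_mono r" "\<And>n. x (r n) \<notin> U" by auto
    have "\<forall>n. (x \<circ> r) n \<in> gromov_points - U" using x r(2) by auto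
    moreover have "gromov_closed b (gromov_points - U)"
      using U by (simp add: openin_gromov_compactification)
    ultimately have "l \<in> gromov_points - U"
      using gromov_converges_subseq[OF conv r(1)] l unfolding gromov_closed_def by blast
    with U show False by blast
  qed
qed

lemma gromov_converges_to_boundary:
  assumes "gromov_converges b (\<lambda>n. Inl (y n)) (Inr \<eta>)" "\<eta> \<in> gromov_boundary"
  shows "filterlim y (to_boundary b \<eta>) sequentially"
  unfolding filterlim_to_boundary_iff[OF assms(2)]
  using assms by (intro gromov_converges_imp_limitin) (auto simp: gromov_points_def)

lemma uniform_limit_rays_to_boundary:
  assumes c: "\<And>n. generalised_ray (c n) (Inl (y n))" "\<And>n. c n 0 = b"
    and c': "geodesic_ray c'" and lim: "\<forall>T. uniform_limit {0..T} c c' sequentially"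
  shows "filterlim y (to_boundary b (vertex c')) sequentially"
proof (rule gromov_converges_to_boundary[OF _ vertex_in_boundary[OF c']])
  have "\<exists>s d. strict_mono (s::nat \<Rightarrow> nat) \<and> generalised_ray d (Inr (vertex c')) \<and>
      (\<forall>T. uniform_limit {0..T} (\<lambda>n. c (r (s n))) d sequentially)" if "strict_mono r" for r :: "nat \<Rightarrow> nat"
  proof -
    have "uniform_limit {0..T} (\<lambda>n. c (r n)) c' sequentially" for T
      using filterlim_compose[OF lim[rule_format] filterlim_subseq[OF that]] .
    then show ?thesis
      using c' by (intro exI[of _ id] exI[of _ c']) (simp add: strict_mono_id)
  qed
  then show "gromov_converges b (\<lambda>n. Inl (y n)) (Inr (vertex c'))"
    unfolding gromov_converges_def using c by blast
qed

text \<open>The geodesics from \<open>b\<close> to \<open>\<gamma> n\<close> stay uniformly close to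
  \<gamma> by \<open>fellow_travel_ray\<close>. The bound survives in the limit, so every
  subsequential limit ray is asymptotic to \<gamma>, although it starts at \<open>b\<close>.\<close>

lemma (in thin_triangles) geodesic_ray_to_vertex:
  fixes b :: 'a
  assumes proper: "proper_space TYPE('a)" and \<gamma>: "geodesic_ray \<gamma>"
  shows "filterlim (\<lambda>n. \<gamma> (real n)) (to_boundary b (vertex \<gamma>)) sequentially"
proof (rule gromov_converges_to_boundary[OF _ vertex_in_boundary[OF \<gamma>]])
  have "\<forall>n. \<exists>c. generalised_ray c (Inl (\<gamma> (real n))) \<and> c 0 = b"
    by (meson generalised_ray_exists[OF geodesic])
  then obtain c where c: "\<And>n. generalised_ray (c n) (Inl (\<gamma> (real n)))" "\<And>n. c n 0 = b"
    by metis
  have dist_b: "real n - dist b (\<gamma> 0) \<le> dist b (\<gamma> (real n))" for n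
    using dist_triangle[of "\<gamma> 0" "\<gamma> (real n)" b] geodesic_ray_dist[OF \<gamma>, of 0 "real n"]
    by (simp add: dist_commute)
  have "filterlim (\<lambda>n. - dist b (\<gamma> 0) + real n) at_top sequentially"
    by (rule filterlim_tendsto_add_at_top[OF tendsto_const filterlim_real_sequentially])
  then have top: "filterlim (\<lambda>n. dist b (\<gamma> (real n))) at_top sequentially"
    by (rule filterlim_at_top_mono) (use dist_b in \<open>simp add: algebra_simps\<close>)
  have "\<exists>s c'. strict_mono (s::nat \<Rightarrow> nat) \<and> generalised_ray c' (Inr (vertex \<gamma>)) \<and>
      (\<forall>T. uniform_limit {0..T} (\<lambda>n. c (q (s n))) c' sequentially)" if q: "strict_mono q" for q :: "nat \<Rightarrow> nat"
  proof -
    have qtop: "filterlim (\<lambda>n. dist b (\<gamma> (real (q n)))) at_top sequentially"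
      using filterlim_compose[OF top filterlim_subseq[OF q]] .
    obtain s c' where s: "strict_mono (s :: nat \<Rightarrow> nat)" and c': "geodesic_ray c'"
      and lim: "\<forall>T. uniform_limit {0..T} (\<lambda>n. c (q (s n))) c' sequentially"
      by (rule generalised_rays_subsequence[where c = "\<lambda>n. c (q n)", OF proper c(1) c(2) qtop])
    have "dist (c' t) (\<gamma> t) \<le> 2 * \<delta> + 2 * dist b (\<gamma> 0)" if t: "t \<ge> 0" for t
    proof (rule tendsto_upperbound)
      have "(\<lambda>n. c (q (s n)) t) \<longlonglongrightarrow> c' t"
        by (rule tendsto_uniform_limitI[OF lim[rule_format, of t]]) (use t in simp)
      then show "(\<lambda>n. dist (c (q (s n)) t) (\<gamma> t)) \<longlonglongrightarrow> dist (c' t) (\<gamma> t)"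
        by (intro tendsto_intros)
      have "filterlim (\<lambda>n. dist b (\<gamma> (real (q (s n))))) at_top sequentially"
        using filterlim_compose[OF qtop filterlim_subseq[OF s]] .
      then have "\<forall>\<^sub>F n in sequentially. t \<le> dist b (\<gamma> (real (q (s n))))"
        unfolding filterlim_at_top by blast
      then show "\<forall>\<^sub>F n in sequentially. dist (c (q (s n)) t) (\<gamma> t) \<le> 2 * \<delta> + 2 * dist b (\<gamma> 0)"
        by eventually_elim (rule fellow_travel_ray[OF \<gamma> _ c t], auto)
    qed simp
    then have "vertex c' = vertex \<gamma>"
      by (rule vertex_eqI[OF c' \<gamma>])
    with s c' lim show ?thesis by auto
  qed
  then show "gromov_converges b (\<lambda>n. Inl (\<gamma> (real n))) (Inr (vertex \<gamma>))"
    unfolding gromov_converges_def using c by blast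
qed


section \<open>Horofunctions at boundary points\<close>

lemma class_mod_const_eq_iff:
  "class_mod_const g = class_mod_const h \<longleftrightarrow> (\<forall>x q. g x - g q = h x - h q)"
proof
  assume "class_mod_const g = class_mod_const h"
  moreover have "g \<in> class_mod_const g" by (auto simp: class_mod_const_def intro: exI[of _ 0])
  ultimately show "\<forall>x q. g x - g q = h x - h q" by (auto simp: class_mod_const_def)
next
  assume *: "\<forall>x q. g x - g q = h x - h q"
  have "g x = h x + (g q - h q)" for x q
    using *[rule_format, of x q] by simp
  then obtain c where c: "\<And>x. g x = h x + c" by metis
  show "class_mod_const g = class_mod_const h"
  proof (intro equalityI subsetI)
    fix u assume "u \<in> class_mod_const g"
    then obtain k where "\<And>y. u y = g y + k" by (auto simp: class_mod_const_def)
    then show "u \<in> class_mod_const h"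
      by (auto simp: class_mod_const_def c intro!: exI[of _ "c + k"])
  next
    fix u assume "u \<in> class_mod_const h"
    then obtain k where "\<And>y. u y = h y + k" by (auto simp: class_mod_const_def)
    then show "u \<in> class_mod_const g"
      by (auto simp: class_mod_const_def c intro!: exI[of _ "k - c"])
  qed
qed

text \<open>Differences ignore additive constants, so a condition on \<open>g x - g q\<close> cuts
  out a saturated set \<open>V\<close>. It is open because it only tests the compact set
  \<open>{x, q}\<close>, hence its image is open in the quotient.\<close>

lemma limitin_quotient_ucc_differences:
  assumes lim: "limitin quotient_ucc_topology (\<lambda>z. class_mod_const (k z)) (class_mod_const h) F"
    and h: "h \<in> cont_functions" and k: "\<And>z. k z \<in> cont_functions"
  shows "((\<lambda>z. k z x - k z q) \<longlongrightarrow> h x - h q) F"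
proof (rule tendstoI)
  fix e :: real assume e: "e > 0"
  define V where "V = {g \<in> cont_functions. \<bar>(g x - g q) - (h x - h q)\<bar> < e}"
  have V: "g \<in> V \<longleftrightarrow> g' \<in> V"
    if "class_mod_const g = class_mod_const g'" "g \<in> cont_functions" "g' \<in> cont_functions" for g g'
    using that by (auto simp: V_def class_mod_const_eq_iff)
  have "openin ucc_topology V"
    unfolding openin_ucc_topology
  proof (intro conjI ballI)
    fix g assume g: "g \<in> V"
    \<comment> \<open>Half of the remaining slack, because the values at \<open>x\<close> and at
      \<open>q\<close> may both move.\<close>
    define r where "r = (e - \<bar>(g x - g q) - (h x - h q)\<bar>) / 2"
    have r: "r > 0" using g by (simp add: V_def r_def)
    have "{g' \<in> cont_functions. \<forall>y\<in>{x, q}. \<bar>g' y - g y\<bar> < r} \<subseteq> V"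
    proof
      fix g' assume *: "g' \<in> {g' \<in> cont_functions. \<forall>y\<in>{x, q}. \<bar>g' y - g y\<bar> < r}"
      then have "\<bar>g' x - g x\<bar> < r" "\<bar>g' q - g q\<bar> < r" by auto
      then have "\<bar>(g' x - g' q) - (h x - h q)\<bar> < e" unfolding r_def by argo
      with * show "g' \<in> V" by (simp add: V_def)
    qed
    with r show "\<exists>K e. compact K \<and> e > 0 \<and> {g' \<in> cont_functions. \<forall>y\<in>K. \<bar>g' y - g y\<bar> < e} \<subseteq> V"
      by (intro exI[of _ "{x, q}"] exI[of _ r]) auto
  qed (auto simp: V_def)
  moreover have "{g \<in> cont_functions. class_mod_const g \<in> class_mod_const ` V} = V"
  proof
    show "V \<subseteq> {g \<in> cont_functions. class_mod_const g \<in> class_mod_const ` V}" by (auto simp: V_def)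
    show "{g \<in> cont_functions. class_mod_const g \<in> class_mod_const ` V} \<subseteq> V"
    proof clarify
      fix g g' assume *: "g \<in> cont_functions" "class_mod_const g = class_mod_const g'" "g' \<in> V"
      then have "g' \<in> cont_functions" by (simp add: V_def)
      with V[OF *(2)] * show "g \<in> V" by blast
    qed
  qed
  ultimately have "openin quotient_ucc_topology (class_mod_const ` V)"
    unfolding openin_quotient_ucc_topology by (auto simp: V_def)
  moreover have "class_mod_const h \<in> class_mod_const ` V" using h e by (auto simp: V_def)
  ultimately have "\<forall>\<^sub>F z in F. class_mod_const (k z) \<in> class_mod_const ` V"
    using lim by (simp add: limitin_def)
  then show "\<forall>\<^sub>F z in F. dist (k z x - k z q) (h x - h q) < e"
  proof eventually_elim
    case (elim z)
    then obtain g where g: "g \<in> V" "class_mod_const (k z) = class_mod_const g" by auto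
    then have "k z \<in> V" using V[OF g(2) k] by (simp add: V_def)
    then show ?case by (simp add: V_def dist_real_def)
  qed
qed

text \<open>\<open>H \<eta>\<close> represents the image of \<eta> under the inverse homeomorphism
  \<Psi>. Continuity of \<Psi> gives the limits, and injectivity of \<Psi> separates boundary
  points; a single \<open>H\<close> for all of them makes the separation expressible.\<close>

lemma exists_horofunctions:
  fixes b :: "'a::metric_space"
  assumes "compactifications_equivalent b"
  shows "\<exists>H :: (real \<Rightarrow> 'a) set \<Rightarrow> 'a \<Rightarrow> real.
    (\<forall>\<eta>\<in>gromov_boundary. \<forall>x q. ((\<lambda>z. dist z x - dist z q) \<longlongrightarrow> H \<eta> x - H \<eta> q) (to_boundary b \<eta>)) \<and>
    (\<forall>\<xi>\<in>gromov_boundary. \<forall>\<eta>\<in>gromov_boundary. (\<forall>x q. H \<xi> x - H \<xi> q = H \<eta> x - H \<eta> q) \<longrightarrow> \<xi> = \<eta>)"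
proof -
  let ?Hor = "horofunction_compactification :: ('a \<Rightarrow> real) set topology"
  let ?G = "gromov_compactification b"
  from assms obtain \<Phi> \<Psi> where maps: "homeomorphic_maps ?Hor ?G \<Phi> \<Psi>"
    and \<Phi>: "\<And>x. \<Phi> (horo_embedding x) = Inl x"
    unfolding compactifications_equivalent_def homeomorphic_map_maps by blast
  have dist_cont: "(\<lambda>y. dist x y) \<in> cont_functions" for x :: 'a
    by (auto simp: cont_functions_def intro!: continuous_intros)
  then have range: "range horo_embedding \<subseteq> topspace (quotient_ucc_topology :: ('a \<Rightarrow> real) set topology)"
    by (auto simp: topspace_quotient_ucc_topology horo_embedding_def)
  have "horo_embedding x \<in> topspace ?Hor" for x
    using closure_of_subset[OF range] range by (auto simp: horofunction_compactification_def)
  then have \<Psi>_Inl: "\<Psi> (Inl x) = horo_embedding x" for x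
    using maps \<Phi>[of x] by (metis homeomorphic_maps_def)
  have bd: "Inr \<eta> \<in> topspace ?G" if "\<eta> \<in> gromov_boundary" for \<eta>
    using that by (simp add: topspace_gromov_compactification gromov_points_def)
  have "\<exists>h\<in>cont_functions. class_mod_const h = \<Psi> (Inr \<eta>)" if "\<eta> \<in> gromov_boundary" for \<eta>
  proof -
    have "\<Psi> (Inr \<eta>) \<in> topspace ?Hor"
      using maps bd[OF that] by (auto simp: homeomorphic_maps_def continuous_map_def)
    then show ?thesis
      by (auto simp: horofunction_compactification_def topspace_quotient_ucc_topology)
  qed
  then obtain H where H: "\<And>\<eta>. \<eta> \<in> gromov_boundary \<Longrightarrow> H \<eta> \<in> cont_functions"
      "\<And>\<eta>. \<eta> \<in> gromov_boundary \<Longrightarrow> class_mod_const (H \<eta>) = \<Psi> (Inr \<eta>)"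
    by metis
  have "((\<lambda>z. dist z x - dist z q) \<longlongrightarrow> H \<eta> x - H \<eta> q) (to_boundary b \<eta>)"
    if \<eta>: "\<eta> \<in> gromov_boundary" for \<eta> x q
  proof -
    have "limitin ?G Inl (Inr \<eta>) (to_boundary b \<eta>)"
      by (rule iffD1[OF filterlim_to_boundary_iff[OF \<eta>, of "\<lambda>z. z"] filterlim_ident])
    moreover have "continuous_map ?G ?Hor \<Psi>" using maps by (simp add: homeomorphic_maps_def)
    ultimately have "limitin ?Hor (\<Psi> \<circ> Inl) (\<Psi> (Inr \<eta>)) (to_boundary b \<eta>)"
      by (rule continuous_map_limit[rotated])
    then have "limitin quotient_ucc_topology (\<lambda>z. class_mod_const (\<lambda>y. dist z y)) (class_mod_const (H \<eta>))
        (to_boundary b \<eta>)"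
      by (simp add: horofunction_compactification_def limitin_subtopology o_def \<Psi>_Inl H(2)[OF \<eta>]
          horo_embedding_def)
    from limitin_quotient_ucc_differences[OF this H(1)[OF \<eta>] dist_cont] show ?thesis .
  qed
  moreover have "\<xi> = \<eta>" if "\<xi> \<in> gromov_boundary" "\<eta> \<in> gromov_boundary"
    "\<forall>x q. H \<xi> x - H \<xi> q = H \<eta> x - H \<eta> q" for \<xi> \<eta>
  proof -
    have "\<Psi> (Inr \<xi>) = \<Psi> (Inr \<eta>)"
      using that(3) H(2)[OF that(1)] H(2)[OF that(2)] class_mod_const_eq_iff by metis
    then have "\<Phi> (\<Psi> (Inr \<xi>)) = \<Phi> (\<Psi> (Inr \<eta>))" by simp
    then show ?thesis
      using maps bd[OF that(1)] bd[OF that(2)] by (simp add: homeomorphic_maps_def)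
  qed
  ultimately show ?thesis by blast
qed

text \<open>Separation of boundary points is reduced to uniqueness of real limits: both
  horofunctions arise as limits of the same distance differences.\<close>

lemma to_boundary_unique:
  assumes "compactifications_equivalent b" "\<xi> \<in> gromov_boundary" "\<eta> \<in> gromov_boundary" "F \<noteq> bot"
    and y: "filterlim y (to_boundary b \<xi>) F" "filterlim y (to_boundary b \<eta>) F"
  shows "\<xi> = \<eta>"
proof -
  obtain H where
    lim: "\<forall>\<zeta>\<in>gromov_boundary. \<forall>x q.
      ((\<lambda>z. dist z x - dist z q) \<longlongrightarrow> H \<zeta> x - H \<zeta> q) (to_boundary b \<zeta>)"
    and inj: "\<forall>\<xi>\<in>gromov_boundary. \<forall>\<eta>\<in>gromov_boundary.
      (\<forall>x q. H \<xi> x - H \<xi> q = H \<eta> x - H \<eta> q) \<longrightarrow> \<xi> = \<eta>"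
    using exists_horofunctions[OF assms(1)] by (elim exE conjE)
  have "H \<xi> x - H \<xi> q = H \<eta> x - H \<eta> q" for x q
    using tendsto_unique[OF assms(4) filterlim_compose[OF lim[rule_format, OF assms(2)] y(1)]
        filterlim_compose[OF lim[rule_format, OF assms(3)] y(2)]] .
  with inj assms(2,3) show ?thesis by blast
qed


section \<open>Non-expanding maps near a boundary point\<close>

text \<open>Once \<open>n\<close> exceeds \<open>s\<close>, the point \<open>\<gamma> s\<close> lies
  between \<open>\<gamma> 0\<close> and \<open>\<gamma> n\<close>, so the difference of distances is
  exactly \<open>- s\<close>.\<close>

lemma horofunction_along_ray:
  assumes h: "\<And>x q. ((\<lambda>z. dist z x - dist z q) \<longlongrightarrow> h x - h q) F"
    and \<gamma>: "geodesic_ray \<gamma>" "filterlim (\<lambda>n. \<gamma> (real n)) F sequentially" and s: "s \<ge> 0"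
  shows "h (\<gamma> s) = h (\<gamma> 0) - s"
proof -
  have "(\<lambda>n. dist (\<gamma> (real n)) (\<gamma> s) - dist (\<gamma> (real n)) (\<gamma> 0)) \<longlonglongrightarrow> h (\<gamma> s) - h (\<gamma> 0)"
    by (rule filterlim_compose[OF h \<gamma>(2)])
  moreover have "\<forall>\<^sub>F n in sequentially. dist (\<gamma> (real n)) (\<gamma> s) - dist (\<gamma> (real n)) (\<gamma> 0) = - s"
    using eventually_ge_at_top[of "nat \<lceil>s\<rceil>"]
  proof eventually_elim
    case (elim n)
    then have "s \<le> real n" by linarith
    then show ?case
      using geodesic_ray_dist[OF \<gamma>(1), of "real n" s] geodesic_ray_dist[OF \<gamma>(1), of "real n" 0] s by simp
  qed
  then have "(\<lambda>n. dist (\<gamma> (real n)) (\<gamma> s) - dist (\<gamma> (real n)) (\<gamma> 0)) \<longlonglongrightarrow> - s"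
    by (rule tendsto_eventually)
  ultimately have "h (\<gamma> s) - h (\<gamma> 0) = - s" by (rule LIMSEQ_unique)
  then show ?thesis by simp
qed

text \<open>Otherwise some sequence \<open>z\<^sub>j \<rightarrow> \<eta>\<close> satisfies the bound while \<open>f z\<^sub>j\<close> accumulates elsewhere.
  Comparing with \<open>f (\<gamma> i) \<rightarrow> \<eta>\<close>, the Gromov product of \<open>f z\<^sub>j\<close> and \<open>f (\<gamma> i)\<close> at \<open>b\<close> is at least
  \<open>i - K\<close> for \<open>i \<le> j\<close>, because \<open>f\<close> shrinks the distance from \<open>z\<^sub>j\<close> to \<open>\<gamma> i\<close> but not, up to \<open>C\<close>,
  the distance from \<open>z\<^sub>j\<close> to \<open>p\<close>.  So both sequences have the same limit.\<close>

lemma (in thin_triangles) non_expanding_filterlim_boundary: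
  fixes b p :: 'a
  assumes proper: "proper_space TYPE('a)" and equiv: "compactifications_equivalent b"
    and f: "non_expanding f" and \<gamma>: "geodesic_ray \<gamma>" "vertex \<gamma> = \<eta>"
    and f\<gamma>: "filterlim (\<lambda>i. f (\<gamma> (real i))) (to_boundary b \<eta>) sequentially"
  shows "filterlim f (to_boundary b \<eta>)
    (inf (to_boundary b \<eta>) (principal {z. dist z p - dist (f z) p < C}))"
proof (rule ccontr)
  let ?F = "to_boundary b \<eta>"
  assume "\<not> ?thesis"
  then obtain P where P: "eventually P ?F"
    and notP: "\<not> (\<forall>\<^sub>F z in ?F. dist z p - dist (f z) p < C \<longrightarrow> P (f z))"
    unfolding filterlim_iff eventually_inf_principal by auto
  have \<eta>: "\<eta> \<in> gromov_boundary" using vertex_in_boundary[OF \<gamma>(1)] \<gamma>(2) by simp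
  from exists_horofunctions[OF equiv] \<eta> obtain h
    where h: "\<And>x q. ((\<lambda>z. dist z x - dist z q) \<longlongrightarrow> h x - h q) ?F" by metis
  have h\<gamma>: "h (\<gamma> (real i)) = h (\<gamma> 0) - real i" for i
    by (rule horofunction_along_ray[OF h \<gamma>(1)])
       (use geodesic_ray_to_vertex[OF proper \<gamma>(1), of b] \<gamma>(2) in auto)
  define w where "w i = f (\<gamma> (real i))" for i :: nat
  \<comment> \<open>Collects the losses in \<open>prod\<close>: replacing \<open>p\<close> by
    \<open>b\<close>, the drop bound \<open>C\<close>, the offset of \<open>h\<close> between
    \<open>\<gamma> 0\<close> and \<open>p\<close>, and the slack \<open>1\<close> granted to the
    limits defining \<open>h\<close>.\<close>
  define K where "K = dist b p + C + (h (\<gamma> 0) - h p) + 1"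
  \<comment> \<open>For fixed \<open>j\<close> the finitely many horofunction estimates hold for all
    \<open>z\<close> near \<eta>, while points violating the claim occur arbitrarily close to
    \<eta>; so some \<open>z\<close> does both.\<close>
  have "\<exists>z. dist z p - dist (f z) p < C \<and> \<not> P (f z) \<and>
      (\<forall>i\<le>j. dist z (\<gamma> (real i)) - dist z p < h (\<gamma> 0) - h p - real i + 1)" for j :: nat
  proof -
    have "\<forall>\<^sub>F z in ?F. dist z (\<gamma> (real i)) - dist z p < h (\<gamma> 0) - h p - real i + 1" for i
      by (rule order_tendstoD(2)[OF h]) (simp add: h\<gamma>)
    then have ev: "\<forall>\<^sub>F z in ?F. \<forall>i\<in>{..j}. dist z (\<gamma> (real i)) - dist z p < h (\<gamma> 0) - h p - real i + 1"
      by (intro eventually_ball_finite) auto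
    show ?thesis
    proof (rule ccontr)
      assume none: "\<not> ?thesis"
      from ev have "\<forall>\<^sub>F z in ?F. dist z p - dist (f z) p < C \<longrightarrow> P (f z)"
        by eventually_elim (use none in auto)
      with notP show False by contradiction
    qed
  qed
  from choice[OF allI[OF this]] obtain z where "\<forall>j. dist (z j) p - dist (f (z j)) p < C \<and> \<not> P (f (z j)) \<and>
      (\<forall>i\<le>j. dist (z j) (\<gamma> (real i)) - dist (z j) p < h (\<gamma> 0) - h p - real i + 1)" ..
  then have z: "\<And>j. dist (z j) p - dist (f (z j)) p < C" "\<And>j. \<not> P (f (z j))"
    "\<And>i j. i \<le> j \<Longrightarrow> dist (z j) (\<gamma> (real i)) - dist (z j) p < h (\<gamma> 0) - h p - real i + 1"
    by auto
  define y where "y j = f (z j)" for j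
  have prod: "real i - K \<le> dist b (y j) - dist (y j) (w i)" if "i \<le> j" for i j
  proof -
    have "dist (y j) (w i) \<le> dist (z j) (\<gamma> (real i))"
      using f by (simp add: y_def w_def non_expanding_def)
    moreover have "dist (y j) p \<le> dist b (y j) + dist b p"
      using dist_triangle[of "y j" p b] by (simp add: dist_commute)
    ultimately show ?thesis
      using z(1)[of j] z(3)[OF that] by (simp add: K_def y_def)
  qed
  have dist_y: "real j - K \<le> dist b (y j)" for j
    using prod[of j j] zero_le_dist[of "y j" "w j"] by linarith
  have dist_w: "real i - K \<le> dist b (w i)" for i
    using prod[of i i] dist_triangle[of b "y i" "w i"] by (simp add: dist_commute)
  have "filterlim (\<lambda>n. - K + real n) at_top sequentially"
    by (rule filterlim_tendsto_add_at_top[OF tendsto_const filterlim_real_sequentially])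
  then have top: "filterlim (\<lambda>n. dist b (v n)) at_top sequentially"
    if "\<And>n. real n - K \<le> dist b (v n)" for v
    by (rule filterlim_at_top_mono) (use that in \<open>simp add: algebra_simps\<close>)
  have "\<exists>c. generalised_ray c (Inl v) \<and> c 0 = b" for v :: 'a
    by (meson generalised_ray_exists[OF geodesic])
  then obtain c where c: "\<And>v. generalised_ray (c v) (Inl v)" "\<And>v. c v 0 = b" by metis
  define cy where "cy n = c (y n)" for n
  define cw where "cw n = c (w n)" for n
  have cy: "generalised_ray (cy n) (Inl (y n))" "cy n 0 = b"
    and cw: "generalised_ray (cw n) (Inl (w n))" "cw n 0 = b" for n
    unfolding cy_def cw_def by (rule c)+
  obtain r c' where r: "strict_mono (r :: nat \<Rightarrow> nat)" and c': "geodesic_ray c'"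
    and limy: "\<forall>T. uniform_limit {0..T} (\<lambda>n. cy (r n)) c' sequentially"
    by (rule generalised_rays_subsequence[where c = cy, OF proper cy top[OF dist_y]])
  obtain s e' where s: "strict_mono (s :: nat \<Rightarrow> nat)" and e': "geodesic_ray e'"
    and limw: "\<forall>T. uniform_limit {0..T} (\<lambda>n. cw (s n)) e' sequentially"
    by (rule generalised_rays_subsequence[where c = cw, OF proper cw top[OF dist_w]])
  have "filterlim (\<lambda>n. w (s n)) (to_boundary b (vertex e')) sequentially"
    by (rule uniform_limit_rays_to_boundary[where c = "\<lambda>n. cw (s n)", OF cw e' limw])
  moreover have "filterlim (\<lambda>n. w (s n)) (to_boundary b \<eta>) sequentially"
    using filterlim_compose[OF f\<gamma> filterlim_subseq[OF s]] by (simp add: w_def)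
  ultimately have "vertex e' = \<eta>"
    by (rule to_boundary_unique[OF equiv vertex_in_boundary[OF e'] \<eta> trivial_limit_sequentially])
  moreover have "vertex c' = vertex e'"
  proof (rule vertex_eqI[OF c' e'])
    fix t :: real assume t: "t \<ge> 0"
    have limy_t: "(\<lambda>n. cy (r n) t) \<longlonglongrightarrow> c' t"
      by (rule tendsto_uniform_limitI[OF limy[rule_format, of t]]) (use t in simp)
    have limw_t: "(\<lambda>n. cw (s n) t) \<longlonglongrightarrow> e' t"
      by (rule tendsto_uniform_limitI[OF limw[rule_format, of t]]) (use t in simp)
    have "\<forall>\<^sub>F i in sequentially. dist (cw (s i) t) (e' t) < 1 \<and> nat \<lceil>K + t + \<delta>\<rceil> \<le> i"
      by (intro eventually_conj tendstoD[OF limw_t] eventually_ge_at_top) simp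
    then obtain i where i: "dist (cw (s i) t) (e' t) < 1" "nat \<lceil>K + t + \<delta>\<rceil> \<le> i"
      using eventually_happens'[OF sequentially_bot] by blast
    have "\<forall>\<^sub>F j in sequentially. dist (cy (r j) t) (c' t) < 1 \<and> s i \<le> j"
      by (intro eventually_conj tendstoD[OF limy_t] eventually_ge_at_top) simp
    then obtain j where j: "dist (cy (r j) t) (c' t) < 1" "s i \<le> j"
      using eventually_happens'[OF sequentially_bot] by blast
    \<comment> \<open>The index \<open>i\<close> is chosen first, beyond
      \<open>K + t + \<delta>\<close>, and then \<open>j\<close> so large that \<open>prod\<close>
      applies. Adding \<open>prod\<close> and \<open>dist_w\<close> bounds the Gromov product below
      by \<open>s i - K\<close>, hence by \<open>t + \<delta>\<close>.\<close>
    have "s i \<le> r j" using j(2) seq_suble[OF r, of j] by simp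
    note prod[OF this]
    moreover have "K + t + \<delta> \<le> real (s i)" using i(2) seq_suble[OF s, of i] by linarith
    ultimately have "2 * (t + \<delta>) \<le> dist b (y (r j)) + dist b (w (s i)) - dist (y (r j)) (w (s i))"
      using dist_w[of "s i"] by argo
    from fellow_travel[OF cy cw t this]
    have "dist (cy (r j) t) (cw (s i) t) \<le> 2 * \<delta>" .
    then show "dist (c' t) (e' t) \<le> 2 * \<delta> + 2"
      using i(1) j(1) dist_triangle[of "c' t" "e' t" "cy (r j) t"]
        dist_triangle[of "cy (r j) t" "e' t" "cw (s i) t"]
      by (simp add: dist_commute)
  qed
  moreover have "filterlim (\<lambda>n. y (r n)) (to_boundary b (vertex c')) sequentially"
    by (rule uniform_limit_rays_to_boundary[where c = "\<lambda>n. cy (r n)", OF cy c' limy])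
  ultimately have "\<forall>\<^sub>F n in sequentially. P (y (r n))"
    using P by (simp add: filterlim_iff)
  then show False using z(2) by (simp add: y_def)
qed

text \<open>If the restricted filter were trivial, \<open>u\<close> would eventually be at least
  \<open>C\<close>. Nontriviality is what permits comparing limits along the sublevel set.\<close>

lemma inf_principal_ne_bot_if_Liminf_less:
  assumes "Liminf F (\<lambda>z. ereal (u z)) < ereal C"
  shows "inf F (principal {z. u z < C}) \<noteq> bot"
proof
  assume "inf F (principal {z. u z < C}) = bot"
  then have "\<forall>\<^sub>F z in F. \<not> u z < C"
    by (simp add: trivial_limit_def eventually_inf_principal)
  then have "ereal C \<le> Liminf F (\<lambda>z. ereal (u z))"
    by (intro Liminf_bounded) (auto elim: eventually_mono)
  with assms show False by simp
qed

text \<open>A version of Julia's lemma.\<close>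

lemma horofunction_image_le:
  assumes h: "\<And>x q. ((\<lambda>z. dist z x - dist z q) \<longlongrightarrow> h x - h q) F"
    and f: "non_expanding f"
    and lim: "filterlim f F (inf F (principal {z. dist z p - dist (f z) p < C}))"
    and ne: "inf F (principal {z. dist z p - dist (f z) p < C}) \<noteq> bot"
  shows "h (f x) \<le> h x + C"
proof -
  let ?G = "inf F (principal {z. dist z p - dist (f z) p < C})"
  have "((\<lambda>z. dist (f z) (f x) - dist (f z) p) \<longlongrightarrow> h (f x) - h p) ?G"
    by (rule filterlim_compose[OF h lim])
  moreover have "((\<lambda>z. dist z x - dist z p + C) \<longlongrightarrow> h x - h p + C) ?G"
    by (intro tendsto_add tendsto_const tendsto_mono[OF _ h]) simp
  moreover have "\<forall>\<^sub>F z in ?G. dist (f z) (f x) - dist (f z) p \<le> dist z x - dist z p + C"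
    unfolding eventually_inf_principal
  proof (intro always_eventually allI impI)
    \<comment> \<open>Non-expansion bounds \<open>dist (f z) (f x)\<close> by
      \<open>dist z x\<close>, and the drop bound gives
      \<open>dist z p < dist (f z) p + C\<close>.\<close>
    fix z assume "z \<in> {z. dist z p - dist (f z) p < C}"
    then show "dist (f z) (f x) - dist (f z) p \<le> dist z x - dist z p + C"
      using f unfolding non_expanding_def by (smt (verit) mem_Collect_eq)
  qed
  ultimately have "h (f x) - h p \<le> h x - h p + C"
    using ne by (intro tendsto_le[of ?G]) auto
  then show ?thesis by simp
qed

lemma horofunction_Lipschitz:
  assumes h: "\<And>x q. ((\<lambda>z. dist z x - dist z q) \<longlongrightarrow> h x - h q) F" and "F \<noteq> bot"
  shows "h x - h q \<le> dist x q"
  by (rule tendsto_upperbound[OF h _ assms(2)])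
     (use dist_triangle[of _ x q] in \<open>simp add: diff_le_eq dist_commute add.commute\<close>)

section \<open>Drops of the distance to \<open>p\<close> along orbits\<close>

lemma non_expanding_dist_drop:
  assumes "non_expanding f"
  shows "- dist p (f p) \<le> dist z p - dist (f z) p"
  using assms dist_triangle[of "f z" p "f p"]
  unfolding non_expanding_def by (smt (verit) dist_commute)

lemma sum_dist_drop_iterates:
  "(\<Sum>k<n. dist ((f ^^ k) z) p - dist (f ((f ^^ k) z)) p) = dist z p - dist ((f ^^ n) z) p"
  by (induction n) auto

text \<open>The value \<open>\<infinity>\<close> is excluded by moving the base point, which changes
  each drop by at most \<open>2 * dist p q\<close>; the value \<open>-\<infinity>\<close> is
  excluded by the uniform lower bound \<open>- dist p (f p)\<close>.\<close>

lemma log_dilation_finite: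
  assumes f: "non_expanding f" and fin: "dilation b \<eta> q f < \<infinity>"
  obtains r where "log_dilation b \<eta> p f = ereal r"
proof -
  let ?F = "to_boundary b \<eta>"
  have "log_dilation b \<eta> q f \<noteq> \<infinity>"
    using fin by (auto simp: dilation_def exp_ereal_def)
  then obtain C where C: "log_dilation b \<eta> q f < ereal C"
    using less_PInf_Ex_of_nat[of "log_dilation b \<eta> q f"] by auto
  have "log_dilation b \<eta> p f \<noteq> \<infinity>"
  proof
    assume "log_dilation b \<eta> p f = \<infinity>"
    then have "\<forall>\<^sub>F z in ?F. ereal (C + 2 * dist p q) < ereal (dist z p - dist (f z) p)"
      unfolding log_dilation_def by (intro less_LiminfD) simp
    then have "\<forall>\<^sub>F z in ?F. ereal C \<le> ereal (dist z q - dist (f z) q)"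
    proof eventually_elim
      case (elim z)
      then show ?case
        using dist_triangle[of z p q] dist_triangle[of "f z" q p] by (simp add: dist_commute)
    qed
    then have "ereal C \<le> log_dilation b \<eta> q f"
      unfolding log_dilation_def by (rule Liminf_bounded)
    with C show False by simp
  qed
  moreover have "ereal (- dist p (f p)) \<le> log_dilation b \<eta> p f"
    unfolding log_dilation_def
    by (intro Liminf_bounded always_eventually allI) (simp add: non_expanding_dist_drop[OF f] del: uminus_ereal.simps)
  ultimately show ?thesis using that by (cases "log_dilation b \<eta> p f") auto
qed

text \<open>On the points where \<open>d(z,p) - d(f\<^sup>n z,p) \<le> n \<ell>\<close> every single step \<open>f\<^sup>k z \<mapsto> f\<^sup>k\<^sup>+\<^sup>1 z\<close> has
  bounded drop, since no drop is below \<open>- d(p, f p)\<close>.  Hence all iterates tend to the boundary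
  point as \<open>z\<close> does, and each drop eventually exceeds \<open>\<ell>\<close>.\<close>

lemma eventually_iterate_drop_gt:
  fixes u :: "'a::metric_space \<Rightarrow> real"
  assumes f: "non_expanding f" and n: "n \<ge> 1"
    and u: "u = (\<lambda>z. dist z p - dist (f z) p)"
    and lim: "\<And>C. filterlim f F (inf F (principal {z. u z < C}))"
    and ev: "\<forall>\<^sub>F z in F. l < u z"
  shows "\<forall>\<^sub>F z in F. real n * l < dist z p - dist ((f ^^ n) z) p"
proof -
  define D where "D = dist p (f p)"
  define S where "S = {z. dist z p - dist ((f ^^ n) z) p \<le> real n * l}"
  \<comment> \<open>One drop is the total, at most \<open>n * l\<close> on \<open>S\<close>, minus
    the others, each at least \<open>- D\<close>; the final \<open>1\<close> makes the bound
    strict.\<close>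
  define C where "C = real n * l + real n * D + 1"
  have sum_u: "(\<Sum>k<n. u ((f ^^ k) z)) = dist z p - dist ((f ^^ n) z) p" for z
    unfolding u by (rule sum_dist_drop_iterates)
  have u_ge: "- D \<le> u z" for z
    unfolding u D_def by (rule non_expanding_dist_drop[OF f])
  have u_less: "u ((f ^^ k) z) < C" if "z \<in> S" "k < n" for z k
  proof -
    have "(\<Sum>j<n. u ((f ^^ j) z)) = u ((f ^^ k) z) + (\<Sum>j\<in>{..<n} - {k}. u ((f ^^ j) z))"
      using that(2) by (intro sum.remove) auto
    moreover have "(\<Sum>j\<in>{..<n} - {k}. - D) \<le> (\<Sum>j\<in>{..<n} - {k}. u ((f ^^ j) z))"
      by (intro sum_mono u_ge)
    moreover have "real (card ({..<n} - {k})) * D \<le> real n * D"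
      using card_mono[of "{..<n}" "{..<n} - {k}"] by (intro mult_right_mono) (auto simp: D_def)
    ultimately show ?thesis using that(1) sum_u[of z] by (simp add: S_def C_def)
  qed
  have iter: "filterlim (f ^^ k) F (inf F (principal S))" if "k \<le> n" for k
    using that
  proof (induction k)
    case 0
    then show ?case by (simp add: filterlim_def id_def)
  next
    case (Suc k)
    have "filterlim (f ^^ k) (inf F (principal {z. u z < C})) (inf F (principal S))"
      using Suc u_less by (auto simp: filterlim_inf filterlim_principal eventually_inf_principal)
    from filterlim_compose[OF lim this] show ?case by (simp add: o_def)
  qed
  have "\<forall>\<^sub>F z in inf F (principal S). \<forall>k\<in>{..<n}. l < u ((f ^^ k) z)"
    by (intro eventually_ball_finite ballI eventually_compose_filterlim[OF ev iter]) auto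
  then have "\<forall>\<^sub>F z in inf F (principal S). False"
  proof (rule eventually_rev_mp, unfold eventually_inf_principal, intro always_eventually allI impI)
    fix z assume z: "z \<in> S" and gt: "\<forall>k\<in>{..<n}. l < u ((f ^^ k) z)"
    \<comment> \<open>The telescoped sum is at most \<open>n * l\<close> on \<open>S\<close>, so
      drops all exceeding \<open>l\<close> are impossible there; strictness uses
      \<open>n \<ge> 1\<close>. Hence points near the boundary point avoid \<open>S\<close>.\<close>
    have "(\<Sum>k<n. l) < (\<Sum>k<n. u ((f ^^ k) z))"
      using gt n by (intro sum_strict_mono) (auto simp: lessThan_empty_iff)
    then show False using z by (simp add: sum_u S_def)
  qed
  then show ?thesis
    by (simp add: eventually_inf_principal S_def not_le)
qed

section \<open>The dilation of an iterate\<close>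

lemma horofunction_iterate_le:
  fixes h :: "'a \<Rightarrow> real"
  assumes "\<And>x. h (f x) \<le> h x + r"
  shows "h ((f ^^ n) x) \<le> h x + real n * r"
proof (induction n)
  case (Suc n)
  then show ?case using assms[of "(f ^^ n) x"] by (simp add: algebra_simps)
qed simp

lemma log_dilation_iterate:
  fixes b p :: "'a::metric_space"
  assumes proper: "proper_space TYPE('a)" and geod: "geodesic_space TYPE('a)"
    and hyp: "gromov_hyperbolic TYPE('a)" and equiv: "compactifications_equivalent b"
    and f: "non_expanding f" and brfp: "boundary_regular_fixed_point b f \<eta>"
    and n: "n \<ge> 1" and r: "log_dilation b \<eta> p f = ereal r"
  shows "log_dilation b \<eta> p (f ^^ n) = ereal (real n * r)"
proof -
  obtain \<delta> where "thin_triangles TYPE('a) \<delta>" by (rule thin_trianglesE[OF geod hyp])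
  then interpret thin_triangles \<delta> .
  let ?F = "to_boundary b \<eta>"
  define u where "u = (\<lambda>z. dist z p - dist (f z) p)"
  have \<eta>: "\<eta> \<in> gromov_boundary" using brfp by (simp add: boundary_regular_fixed_point_def)
  obtain \<gamma> where \<gamma>: "geodesic_ray \<gamma>" "vertex \<gamma> = \<eta>" by (rule gromov_boundaryE[OF \<eta>])
  have lim\<gamma>: "filterlim (\<lambda>i. \<gamma> (real i)) ?F sequentially"
    using geodesic_ray_to_vertex[OF proper \<gamma>(1), of b] \<gamma>(2) by simp
  have F: "?F \<noteq> bot" using eventually_compose_filterlim[OF _ lim\<gamma>, of "\<lambda>_. False"] by (auto simp: trivial_limit_def)
  \<comment> \<open>The ray lies in its own geodesic region, so the geodesic limit of
    \<open>f\<close> at \<eta> may be tested on the points \<open>\<gamma> i\<close>.\<close>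
  have region: "\<gamma> (real i) \<in> geodesic_region \<gamma> 1" for i
    by (simp add: geodesic_region_def neighborhood_def)
  have "has_geodesic_limit b f (Inr \<eta>) \<eta>"
    using brfp by (simp add: boundary_regular_fixed_point_def)
  from this[unfolded has_geodesic_limit_def, rule_format, of \<gamma> 1 "\<lambda>i. \<gamma> (real i)"]
  have f\<gamma>: "filterlim (\<lambda>i. f (\<gamma> (real i))) ?F sequentially"
    using \<gamma> lim\<gamma> region by (simp add: filterlim_to_boundary_iff[OF \<eta>])
  have limf: "filterlim f ?F (inf ?F (principal {z. u z < C}))" for C
    unfolding u_def by (rule non_expanding_filterlim_boundary[OF proper equiv f \<gamma> f\<gamma>])
  from exists_horofunctions[OF equiv] \<eta> obtain h
    where h: "\<And>x q. ((\<lambda>z. dist z x - dist z q) \<longlongrightarrow> h x - h q) ?F" by metis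

  have "ereal (real n * r) \<le> log_dilation b \<eta> p (f ^^ n)"
    unfolding log_dilation_def le_Liminf_iff
  proof (intro allI impI)
    fix y assume "y < ereal (real n * r)"
    then obtain a where a: "y < ereal a" "a < real n * r" using ereal_dense2 by force
    \<comment> \<open>Distributes the target \<open>a\<close> equally over the \<open>n\<close>
      steps; \<open>l < r\<close> is then eventually exceeded by a single drop.\<close>
    define l where "l = a / real n"
    have l: "real n * l = a" "l < r" using a(2) n by (simp_all add: l_def field_simps)
    have "\<forall>\<^sub>F z in ?F. ereal l < ereal (u z)"
      using r l(2) unfolding log_dilation_def u_def by (intro less_LiminfD) simp
    then have "\<forall>\<^sub>F z in ?F. l < u z" by simp
    from eventually_iterate_drop_gt[OF f n u_def limf this]
    show "\<forall>\<^sub>F z in ?F. y < ereal (dist z p - dist ((f ^^ n) z) p)"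
      using a(1) unfolding l(1) by (auto elim!: eventually_mono intro: less_trans)
  qed
  moreover have "log_dilation b \<eta> p (f ^^ n) \<le> ereal (real n * r)"
  proof (rule ccontr)
    assume "\<not> ?thesis"
    then obtain a where a: "real n * r < a" "ereal a < log_dilation b \<eta> p (f ^^ n)"
      using ereal_dense2[of "ereal (real n * r)" "log_dilation b \<eta> p (f ^^ n)"] by (auto simp: not_le)
    \<comment> \<open>As the limit inferior is \<open>r\<close>, drops below \<open>r + e\<close>
      occur arbitrarily near \<eta> for every \<open>e > 0\<close>, so the Julia-type estimate
      applies with \<open>C = r + e\<close>.\<close>
    have "h (f x) \<le> h x + r" for x
    proof (rule field_le_epsilon)
      fix e :: real assume "e > 0"
      then have "inf ?F (principal {z. u z < r + e}) \<noteq> bot"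
        using r by (intro inf_principal_ne_bot_if_Liminf_less) (simp add: log_dilation_def u_def)
      from horofunction_image_le[OF h f limf[unfolded u_def] this[unfolded u_def]]
      show "h (f x) \<le> h x + r + e" by (simp add: add.assoc)
    qed
    then have iter: "h ((f ^^ n) x) \<le> h x + real n * r" for x
      by (rule horofunction_iterate_le)
    have "\<forall>\<^sub>F z in ?F. a < dist z p - dist ((f ^^ n) z) p"
      using less_LiminfD[OF a(2)[unfolded log_dilation_def]] by simp
    then have ev: "\<forall>\<^sub>F i in sequentially. a < dist (\<gamma> (real i)) p - dist ((f ^^ n) (\<gamma> (real i))) p"
      using lim\<gamma> by (rule eventually_compose_filterlim)
    have "\<forall>\<^sub>F i in sequentially. a \<le> dist (\<gamma> (real i)) p - dist (\<gamma> (real i)) (\<gamma> 0) + (h (\<gamma> 0) - h p) + real n * r"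
      using ev
    proof eventually_elim
      case (elim i)
      let ?x = "\<gamma> (real i)"
      \<comment> \<open>The Lipschitz bound on \<open>h\<close> keeps the image of \<open>?x\<close>
        away from \<open>p\<close>: its distance is at least \<open>h p - h ?x - n * r\<close>, and
        \<open>h ?x\<close> is explicit on the ray.\<close>
      have "h p - h ((f ^^ n) ?x) \<le> dist ((f ^^ n) ?x) p"
        using horofunction_Lipschitz[OF h F, of p "(f ^^ n) ?x"] by (simp add: dist_commute)
      moreover have "h ?x = h (\<gamma> 0) - dist ?x (\<gamma> 0)"
        using horofunction_along_ray[OF h \<gamma>(1) lim\<gamma> of_nat_0_le_iff, of i] geodesic_ray_dist[OF \<gamma>(1), of "real i" 0] by simp
      ultimately show ?case using iter[of ?x] elim by linarith
    qed
    \<comment> \<open>The difference of distances tends to \<open>h p - h (\<gamma> 0)\<close>,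
      which cancels the offset and leaves \<open>a \<le> n * r\<close>.\<close>
    moreover have "(\<lambda>i. dist (\<gamma> (real i)) p - dist (\<gamma> (real i)) (\<gamma> 0) + (h (\<gamma> 0) - h p) + real n * r)
        \<longlonglongrightarrow> (h p - h (\<gamma> 0)) + (h (\<gamma> 0) - h p) + real n * r"
      by (intro tendsto_add tendsto_const filterlim_compose[OF h lim\<gamma>])
    ultimately have "a \<le> (h p - h (\<gamma> 0)) + (h (\<gamma> 0) - h p) + real n * r"
      by (intro tendsto_lowerbound[OF _ _ sequentially_bot])
    with a(1) show False by simp
  qed
  ultimately show ?thesis by (rule antisym[rotated])
qed

theorem proposition3p9:
  fixes f :: "'a::metric_space \<Rightarrow> 'a" and \<eta> :: "(real \<Rightarrow> 'a) set" and b p :: 'a and n :: nat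
  assumes "proper_space TYPE('a)" and "geodesic_space TYPE('a)" and "gromov_hyperbolic TYPE('a)"
    and "compactifications_equivalent b"
    and "non_expanding f"
    and "boundary_regular_fixed_point b f \<eta>"
    and "n \<ge> 1"
  shows "dilation b \<eta> p (f ^^ n) = dilation b \<eta> p f ^ n"
proof -
  \<comment> \<open>Finiteness is given at some base point \<open>q\<close> and is transferred to
    \<open>p\<close>; with a real logarithm, the exponential turns the factor \<open>n\<close> into
    a power.\<close>
  from assms(6) obtain q where "dilation b \<eta> q f < \<infinity>"
    by (auto simp: boundary_regular_fixed_point_def)
  then obtain r where r: "log_dilation b \<eta> p f = ereal r"
    by (rule log_dilation_finite[OF assms(5)])
  show ?thesis
    by (simp add: dilation_def exp_ereal_def r log_dilation_iterate[OF assms r] ennreal_power exp_of_nat_mult)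
qed

end
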